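(* Let $(X_t)_{t\ge 0}$ be a discrete time Markov chain on $\mathcal{X}$ with transition kernel $P$. Assume that $(X_t)$ is reversible with respect to the probability measure $\pi$ on $\mathcal{X}$ and that it has nonnegative eigenvalues. Suppose that $T$ is a strong random time for $(X_t)$ with measure $\nu$ such that $\mathbf{P}_\nu(T \geq 1) = 1$ and $\mathbf{E}_\nu[T] < \infty$. Also assume that $\mathbf{P}_\mu(T < \infty) = 1$ for all probability measures $\mu$ on $\mathcal{X}$. Then $\pi$ is the unique stationary distribution for $(X_t)$, and for all integers $t \geq 0$, \[ \|P^t(\nu,\cdot) - \pi\|_{L^2(\pi)}^2 \leq \sum_{n = 2t+1}^\infty \mathbf{P}_\nu(T > n). \]
   Context: $\mathcal{X}$ is a general (measurable) state space; all subsets $S\subset\mathcal{X}$ and all functions considered are measurable. For a probability measure $\mu$ on $\mathcal{X}$, $\mathbf{P}_\mu$ and $\mathbf{E}_\mu$ denote probability and expectation for the chain $(X_t)$ (together with the random time $T$) started from $X_0\sim\mu$. $P^t(\mu,\cdot)=\mu P^t$ is the law of $X_t$ when $X_0\sim\mu$, where $\mu P(S)=\int_{\mathcal{X}} P(x,S)\,\mu(dx)$, and $Pf(x)=\int_{\mathcal{X}} f(y)P(x,dy)$. A stationary distribution is a probability measure $\pi$ with $\pi P=\pi$. Randomized stopping time: a random time $T$ with values in $\{0,1,2,\dots\}\cup\{\infty\}$ such that for each $n\ge 0$, given $(X_0,\ldots,X_n)$, the event $\{T=n\}$ and the future trajectory $(X_{n+1},X_{n+2},\ldots)$ are conditionally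 independent (so $\{T=n\}$ may depend on the history $(X_0,\dots,X_n)$ and on additional randomness that plays no role in the trajectory of the chain after time $n$). Strong random time: for a fixed probability measure $\nu$ on $\mathcal{X}$, a strong random time for $(X_t)$ with measure $\nu$ is a randomized stopping time $T$ such that for every probability measure $\mu$ on $\mathcal{X}$, $\mathbf{P}_\mu(X_n\in S\mid T=n)=\nu(S)$ for all $n\ge 0$ and $S\subset\mathcal{X}$ (the equality is considered trivially satisfied when $\mathbf{P}_\mu(T=n)=0$). Reversibility: $(X_t)$ is reversible with respect to $\pi$ if $\pi(dx)P(x,dy)=\pi(dy)P(y,dx)$ as measures on $\mathcal{X}\times\mathcal{X}$; equivalently $f\mapsto Pf$ is a self-adjoint operator on the space $L^2(\pi)$ of real-valued functions with inner product $\langle f,g\rangle_\pi=\int fg\,d\pi$. Its spectrum is then contained in $[-1,1]$; the chain has nonnegative eigenvalues if the $L^2(\pi)$ spectrum of $P$ is contained in $[0,1]$. $L^2(\pi)$ distance: for probability measures $\mu,\mu'$, $\|\mu-\mu'\|_{L^2(\pi)}^2=\int_{\mathcal{X}}\big[\frac{d(\mu-\mu')}{d\pi}(x)\big]^2\pi(dx)$ if $\mu-\mu'$ is absolutely continuous with respect to $\pi$, and $+\infty$ otherwise. *)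

theory Defs
  imports "HOL-Probability.Probability"
begin

section \<open>Kernels, stationarity and reversibility\<close>

text \<open>
  A transition kernel on a measurable space \<open>S\<close> is an element of
  \<open>S \<rightarrow>\<^sub>M prob_algebra S\<close>, and \<open>\<mu> \<bind> P\<close> is the measure \<open>\<mu>P\<close>.
  The probability measures on \<open>S\<close> are the elements of \<open>space (prob_algebra S)\<close>.
\<close>

definition law_at :: "('a \<Rightarrow> 'a measure) \<Rightarrow> nat \<Rightarrow> 'a measure \<Rightarrow> 'a measure" where
  "law_at P t \<mu> = ((\<lambda>m. m \<bind> P) ^^ t) \<mu>"

definition stationary_distribution ::
  "'a measure \<Rightarrow> ('a \<Rightarrow> 'a measure) \<Rightarrow> 'a measure \<Rightarrow> bool" where
  "stationary_distribution S P \<mu> \<longleftrightarrow> \<mu> \<in> space (prob_algebra S) \<and> \<mu> \<bind> P = \<mu>"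

text \<open>The two sides are the measures \<open>\<pi>(dx) P(x,dy)\<close> and \<open>\<pi>(dy) P(y,dx)\<close> in the
  variables \<open>(x,y)\<close> on the product space.\<close>

definition reversible :: "'a measure \<Rightarrow> ('a \<Rightarrow> 'a measure) \<Rightarrow> 'a measure \<Rightarrow> bool" where
  "reversible S P \<pi> \<longleftrightarrow>
     \<pi> \<bind> (\<lambda>x. P x \<bind> (\<lambda>y. return (S \<Otimes>\<^sub>M S) (x, y))) =
     \<pi> \<bind> (\<lambda>y. P y \<bind> (\<lambda>x. return (S \<Otimes>\<^sub>M S) (x, y)))"

definition kernel_op :: "('a \<Rightarrow> 'a measure) \<Rightarrow> ('a \<Rightarrow> real) \<Rightarrow> 'a \<Rightarrow> real" where
  "kernel_op P f = (\<lambda>x. \<integral>y. f y \<partial>P x)"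


section \<open>The spectrum on \<open>L\<^sup>2(\<pi>)\<close> and the \<open>L\<^sup>2(\<pi>)\<close> distance\<close>

text \<open>Elements of \<open>L\<^sup>2(\<pi>)\<close> are represented by square-integrable functions, and operators by
  maps on representatives; all identities between them are required \<open>\<pi>\<close>-almost everywhere.\<close>

definition L2_space :: "'a measure \<Rightarrow> ('a \<Rightarrow> real) set" where
  "L2_space \<pi> = {f \<in> borel_measurable \<pi>. integrable \<pi> (\<lambda>x. (f x)\<^sup>2)}"

definition L2_norm :: "'a measure \<Rightarrow> ('a \<Rightarrow> real) \<Rightarrow> real" where
  "L2_norm \<pi> f = sqrt (\<integral>x. (f x)\<^sup>2 \<partial>\<pi>)"

text \<open>Compatibility with almost everywhere equality follows from linearity and boundedness.\<close>

definition L2_bounded_linear ::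
  "'a measure \<Rightarrow> (('a \<Rightarrow> real) \<Rightarrow> 'a \<Rightarrow> real) \<Rightarrow> bool" where
  "L2_bounded_linear \<pi> A \<longleftrightarrow>
     (\<forall>f\<in>L2_space \<pi>. A f \<in> L2_space \<pi>) \<and>
     (\<forall>f\<in>L2_space \<pi>. \<forall>g\<in>L2_space \<pi>. AE x in \<pi>. A (\<lambda>y. f y + g y) x = A f x + A g x) \<and>
     (\<forall>c. \<forall>f\<in>L2_space \<pi>. AE x in \<pi>. A (\<lambda>y. c * f y) x = c * A f x) \<and>
     (\<exists>K. \<forall>f\<in>L2_space \<pi>. L2_norm \<pi> (A f) \<le> K * L2_norm \<pi> f)"

text \<open>The real numbers \<open>c\<close> for which \<open>c - A\<close> has no bounded two-sided inverse.  The operators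
  considered are self-adjoint, so this real spectrum is also the spectrum of the
  complexification.\<close>

definition L2_spectrum ::
  "'a measure \<Rightarrow> (('a \<Rightarrow> real) \<Rightarrow> 'a \<Rightarrow> real) \<Rightarrow> real set" where
  "L2_spectrum \<pi> A =
     {c. \<not> (\<exists>R. L2_bounded_linear \<pi> R \<and>
            (\<forall>f\<in>L2_space \<pi>. AE x in \<pi>. R (\<lambda>y. c * f y - A f y) x = f x) \<and>
            (\<forall>f\<in>L2_space \<pi>. AE x in \<pi>. c * R f x - A (R f) x = f x))}"

definition nonneg_eigenvalues :: "('a \<Rightarrow> 'a measure) \<Rightarrow> 'a measure \<Rightarrow> bool" where
  "nonneg_eigenvalues P \<pi> \<longleftrightarrow> L2_spectrum \<pi> (kernel_op P) \<subseteq> {0..1}"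

text \<open>The density of the signed measure \<open>\<mu> - \<mu>'\<close>: the predicate determines \<open>h\<close> up to
  \<open>\<pi>\<close>-null sets, so the choice in the distance below is immaterial; it is satisfiable, by
  Radon-Nikodym, when \<open>\<mu> - \<mu>'\<close> is absolutely continuous.\<close>

definition density_of_diff ::
  "'a measure \<Rightarrow> 'a measure \<Rightarrow> 'a measure \<Rightarrow> ('a \<Rightarrow> real) \<Rightarrow> bool" where
  "density_of_diff \<pi> \<mu> \<mu>' h \<longleftrightarrow> integrable \<pi> h \<and>
     (\<forall>A\<in>sets \<pi>. measure \<mu> A - measure \<mu>' A = (LINT x:A|\<pi>. h x))"

definition L2_dist_sq :: "'a measure \<Rightarrow> 'a measure \<Rightarrow> 'a measure \<Rightarrow> ennreal" where
  "L2_dist_sq \<pi> \<mu> \<mu>' =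
     (if \<forall>A\<in>sets \<pi>. emeasure \<pi> A = 0 \<longrightarrow> measure \<mu> A - measure \<mu>' A = 0
      then (\<integral>\<^sup>+x. ennreal (((SOME h. density_of_diff \<pi> \<mu> \<mu>' h) x)\<^sup>2) \<partial>\<pi>)
      else \<infinity>)"


section \<open>Markov chains and strong random times\<close>

text \<open>The sigma-algebra generated by \<open>X\<^sub>0, \<dots>, X\<^sub>n\<close>.\<close>

definition history :: "'w measure \<Rightarrow> 'a measure \<Rightarrow> (nat \<Rightarrow> 'w \<Rightarrow> 'a) \<Rightarrow> nat \<Rightarrow> 'w measure" where
  "history Q S X n =
     vimage_algebra (space Q) (\<lambda>\<omega>. \<lambda>i\<in>{..n}. X i \<omega>) (\<Pi>\<^sub>M i\<in>{..n}. S)"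

definition markov_chain ::
  "'a measure \<Rightarrow> ('a \<Rightarrow> 'a measure) \<Rightarrow> 'a measure \<Rightarrow> 'w measure \<Rightarrow> (nat \<Rightarrow> 'w \<Rightarrow> 'a) \<Rightarrow> bool" where
  "markov_chain S P \<mu> Q X \<longleftrightarrow>
     prob_space Q \<and> (\<forall>n. X n \<in> Q \<rightarrow>\<^sub>M S) \<and> distr Q S (X 0) = \<mu> \<and>
     (\<forall>n. \<forall>A\<in>sets S. AE \<omega> in Q.
        real_cond_exp Q (history Q S X n) (indicat_real {\<omega>\<in>space Q. X (Suc n) \<omega> \<in> A}) \<omega>
          = measure (P (X n \<omega>)) A)"

definition cond_indep_events :: "'w measure \<Rightarrow> 'w measure \<Rightarrow> 'w set \<Rightarrow> 'w set \<Rightarrow> bool" where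
  "cond_indep_events Q F A B \<longleftrightarrow>
     (AE \<omega> in Q. real_cond_exp Q F (indicat_real (A \<inter> B)) \<omega> =
        real_cond_exp Q F (indicat_real A) \<omega> * real_cond_exp Q F (indicat_real B) \<omega>)"

definition randomized_stopping_time ::
  "'a measure \<Rightarrow> 'w measure \<Rightarrow> (nat \<Rightarrow> 'w \<Rightarrow> 'a) \<Rightarrow> ('w \<Rightarrow> enat) \<Rightarrow> bool" where
  "randomized_stopping_time S Q X T \<longleftrightarrow>
     T \<in> Q \<rightarrow>\<^sub>M count_space UNIV \<and>
     (\<forall>n. \<forall>B\<in>sets (\<Pi>\<^sub>M k\<in>(UNIV :: nat set). S).
        cond_indep_events Q (history Q S X n)
          {\<omega>\<in>space Q. T \<omega> = enat n}
          {\<omega>\<in>space Q. (\<lambda>k. X (n + 1 + k) \<omega>) \<in> B})"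

text \<open>\<open>Pr \<mu>\<close> is the probability \<open>\<^bold>P\<^sub>\<mu>\<close>, governing the chain and the random time when the
  chain is started from \<open>\<mu>\<close>.\<close>

definition strong_random_time ::
  "'a measure \<Rightarrow> ('a measure \<Rightarrow> 'w measure) \<Rightarrow> (nat \<Rightarrow> 'w \<Rightarrow> 'a) \<Rightarrow> ('w \<Rightarrow> enat) \<Rightarrow> 'a measure \<Rightarrow> bool"
  where
  "strong_random_time S Pr X T \<nu> \<longleftrightarrow>
     (\<forall>\<mu>\<in>space (prob_algebra S).
        randomized_stopping_time S (Pr \<mu>) X T \<and>
        (\<forall>n. \<forall>A\<in>sets S. \<P>(\<omega> in Pr \<mu>. T \<omega> = enat n) \<noteq> 0 \<longrightarrow>
           \<P>(\<omega> in Pr \<mu>. X n \<omega> \<in> A \<bar> T \<omega> = enat n) = measure \<nu> A))"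

end

theory Submission
  imports Defs
begin

text \<open>
  The proof compares the chain with a renewal process.  A strong random time restarts the chain from
  \<open>\<nu>\<close>, so for every initial law \<open>\<mu>\<close> and every set \<open>B\<close> the numbers \<open>a j = (\<nu>P\<^sup>j)(B)\<close> satisfy

  \<open>(\<mu>P\<^sup>n)(B) = (\<Sum>k\<le>n. P\<^sub>\<mu>(T = k) a(n - k)) + P\<^sub>\<mu>(X\<^sub>n \<in> B, T > n)\<close>

  (\<open>renewal_equation\<close>), and the remainder tends to 0.  If \<open>\<mu>\<close> is stationary, the left-hand side is the
  constant \<open>\<mu>(B)\<close>, so \<open>\<mu>(B)\<close> is the limit of an average of \<open>a\<close> with the weights \<open>P\<^sub>\<mu>(T = k)\<close>.
  Two such averages of the same sequence have the same limit, because convolution is commutative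
  (\<open>conv_limits_agree\<close>); hence there is only one stationary distribution, and \<open>\<pi>\<close> is stationary by
  reversibility.

  For \<open>\<mu> = \<nu>\<close> let \<open>Q k = P\<^sub>\<nu>(T > k)\<close>; here \<open>Q 0 = 1\<close>, and the sum of \<open>Q\<close> is the expectation of \<open>T\<close>.
  The renewal equation shows that \<open>Q * a\<close> has the increments \<open>P\<^sub>\<nu>(X\<^sub>n \<in> B, T > n)\<close>.  It therefore
  increases, and averaging it with the weights \<open>P\<^sub>\<pi>(T = k)\<close> identifies its limit as
  \<open>(\<Sum>k. Q k) \<pi>(B)\<close> (\<open>conv_tail_le\<close>).  As measures,

  \<open>(\<Sum>k\<le>n. Q k \<nu>P\<^sup>n\<^sup>-\<^sup>k) \<le> (\<Sum>k. Q k) \<pi>\<close>.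

  In particular \<open>\<nu>\<close> has a bounded density \<open>h\<close> with respect to \<open>\<pi>\<close>, and by reversibility \<open>\<nu>P\<^sup>j\<close> has the
  density \<open>P\<^sup>j h\<close>.  Integrating \<open>h\<close> against the inequality gives
  \<open>(\<Sum>k\<le>n. Q k v(n - k)) \<le> (\<Sum>k. Q k)\<close> for the autocorrelations \<open>v j = \<langle>P\<^sup>j h, h\<rangle>\<close>.  Since
  \<open>v j - 1 = \<langle>P\<^sup>j (h - 1), h - 1\<rangle>\<close> is nonnegative for a positive operator, \<open>v(n - k)\<close> may be replaced by 1
  for all \<open>k > 0\<close>, and what remains is \<open>v n - 1 \<le> (\<Sum>k>n. Q k)\<close>.  For \<open>n = 2 t\<close> the left-hand side is
  the squared distance \<open>\<parallel>P\<^sup>t h - 1\<parallel>\<^sup>2\<close>.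

  The hypothesis on the spectrum enters through \<open>\<langle>Pf, f\<rangle> \<ge> 0\<close> for bounded \<open>f\<close>
  (\<open>ip_A_nonneg\<close>), which is derived from the resolvent at the bottom of the numerical range.
\<close>

section \<open>Bounded functions and the transition operator\<close>

lemma prob_algebraD:
  assumes "\<mu> \<in> space (prob_algebra S)"
  shows "prob_space \<mu>" "sets \<mu> = sets S" "space \<mu> = space S"
  using assms by (auto simp: space_prob_algebra dest: sets_eq_imp_space_eq)

text \<open>All densities that occur below are bounded, so bounded measurable functions take the place of
\<open>L\<^sup>2(\<pi>)\<close>.  On them \<open>kernel_op P\<close> is given pointwise by convergent integrals, and its
algebraic rules hold everywhere on the space instead of almost everywhere.\<close>

definition bounded_functions :: "'a measure \<Rightarrow> ('a \<Rightarrow> real) set" where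
  "bounded_functions S = {f \<in> borel_measurable S. \<exists>C. \<forall>x\<in>space S. \<bar>f x\<bar> \<le> C}"

lemma bounded_functions_measurable: "f \<in> bounded_functions S \<Longrightarrow> f \<in> borel_measurable S"
  by (simp add: bounded_functions_def)

lemma bounded_functionsI:
  "f \<in> borel_measurable S \<Longrightarrow> (\<And>x. x \<in> space S \<Longrightarrow> \<bar>f x\<bar> \<le> C) \<Longrightarrow> f \<in> bounded_functions S"
  by (auto simp: bounded_functions_def)

lemma bounded_functions_add:
  assumes "f \<in> bounded_functions S" "g \<in> bounded_functions S"
  shows "(\<lambda>x. f x + g x) \<in> bounded_functions S"
proof -
  obtain C D where "\<forall>x\<in>space S. \<bar>f x\<bar> \<le> C" "\<forall>x\<in>space S. \<bar>g x\<bar> \<le> D"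
    using assms by (auto simp: bounded_functions_def)
  then show ?thesis
    using assms[THEN bounded_functions_measurable]
    by (intro bounded_functionsI[where C="C + D"]) (auto intro: order_trans[OF abs_triangle_ineq] add_mono)
qed

lemma bounded_functions_mult:
  assumes "f \<in> bounded_functions S" "g \<in> bounded_functions S"
  shows "(\<lambda>x. f x * g x) \<in> bounded_functions S"
proof -
  obtain C D where CD: "\<forall>x\<in>space S. \<bar>f x\<bar> \<le> C" "\<forall>x\<in>space S. \<bar>g x\<bar> \<le> D"
    using assms by (auto simp: bounded_functions_def)
  have "\<bar>f x * g x\<bar> \<le> C * D" if "x \<in> space S" for x
    unfolding abs_mult using CD that by (intro mult_mono) (auto intro: order_trans[OF abs_ge_zero])
  then show ?thesis
    using assms[THEN bounded_functions_measurable]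
    by (intro bounded_functionsI[where C="C * D"]) auto
qed

lemma bounded_functions_const: "(\<lambda>x. c) \<in> bounded_functions S"
  by (rule bounded_functionsI[where C="\<bar>c\<bar>"]) auto

lemma bounded_functions_cmult:
  "f \<in> bounded_functions S \<Longrightarrow> (\<lambda>x. c * f x) \<in> bounded_functions S"
  by (rule bounded_functions_mult[OF bounded_functions_const])

lemma bounded_functions_diff:
  assumes "f \<in> bounded_functions S" "g \<in> bounded_functions S"
  shows "(\<lambda>x. f x - g x) \<in> bounded_functions S"
  using bounded_functions_add[OF assms(1) bounded_functions_cmult[OF assms(2), of "-1"]] by simp

lemma bounded_functions_indicator:
  "A \<in> sets S \<Longrightarrow> indicat_real A \<in> bounded_functions S"
  by (rule bounded_functionsI[where C=1]) (auto simp: indicator_def)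

lemmas bounded_functions_intros =
  bounded_functions_add bounded_functions_mult bounded_functions_const bounded_functions_cmult
  bounded_functions_diff bounded_functions_indicator

lemma integrable_bounded_functions:
  assumes "\<mu> \<in> space (prob_algebra S)" "f \<in> bounded_functions S"
  shows "integrable \<mu> f"
proof -
  note \<mu> = prob_algebraD[OF assms(1)]
  interpret prob_space \<mu> by (rule \<mu>(1))
  obtain C where C: "\<forall>x\<in>space S. \<bar>f x\<bar> \<le> C"
    using assms(2) by (auto simp: bounded_functions_def)
  show ?thesis
  proof (rule integrable_const_bound[where B=C])
    show "AE x in \<mu>. norm (f x) \<le> C"
      using C \<mu>(3) by (intro AE_I2) auto
    show "f \<in> borel_measurable \<mu>"
      using bounded_functions_measurable[OF assms(2)] \<mu>(2) by (simp cong: measurable_cong_sets)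
  qed
qed

lemma kernel_in_prob_algebra:
  "P \<in> S \<rightarrow>\<^sub>M prob_algebra S \<Longrightarrow> x \<in> space S \<Longrightarrow> P x \<in> space (prob_algebra S)"
  by (rule measurable_space)

lemma kernel_op_bounded_functions:
  assumes P: "P \<in> S \<rightarrow>\<^sub>M prob_algebra S" and f: "f \<in> bounded_functions S"
  shows "kernel_op P f \<in> bounded_functions S"
proof -
  obtain C where C: "\<forall>x\<in>space S. \<bar>f x\<bar> \<le> C"
    using f by (auto simp: bounded_functions_def)
  show ?thesis
  proof (rule bounded_functionsI[where C=C])
    show "kernel_op P f \<in> borel_measurable S"
      unfolding kernel_op_def
      using measurable_compose[OF measurable_prob_algebraD[OF P]
          integral_measurable_subprob_algebra[OF bounded_functions_measurable[OF f]]] .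
    fix x assume x: "x \<in> space S"
    have Px: "P x \<in> space (prob_algebra S)" by (rule kernel_in_prob_algebra[OF P x])
    note s = prob_algebraD(3)[OF Px]
    interpret prob_space "P x" by (rule prob_algebraD(1)[OF Px])
    have i: "integrable (P x) f" by (rule integrable_bounded_functions[OF Px f])
    have "\<bar>\<integral>y. f y \<partial>P x\<bar> \<le> (\<integral>y. \<bar>f y\<bar> \<partial>P x)" by (rule integral_abs_bound)
    also have "\<dots> \<le> (\<integral>y. C \<partial>P x)"
      using i C s by (intro integral_mono) auto
    also have "\<dots> = C" by (simp add: prob_space)
    finally show "\<bar>kernel_op P f x\<bar> \<le> C" by (simp add: kernel_op_def)
  qed
qed

lemma kernel_op_indicator:
  assumes "P \<in> S \<rightarrow>\<^sub>M prob_algebra S" "A \<in> sets S" "x \<in> space S"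
  shows "kernel_op P (indicat_real A) x = measure (P x) A"
  using prob_algebraD[OF kernel_in_prob_algebra[OF assms(1,3)]] sets.sets_into_space[OF assms(2)]
  by (simp add: kernel_op_def Int_absorb2)

lemma integral_bind_kernel:
  assumes P: "P \<in> S \<rightarrow>\<^sub>M prob_algebra S" and \<mu>: "\<mu> \<in> space (prob_algebra S)"
    and f: "f \<in> bounded_functions S"
  shows "(\<integral>x. f x \<partial>(\<mu> \<bind> P)) = (\<integral>x. kernel_op P f x \<partial>\<mu>)"
proof -
  obtain C where C: "\<And>x. x \<in> space S \<Longrightarrow> \<bar>f x\<bar> \<le> C"
    using f by (auto simp: bounded_functions_def)
  note s = prob_algebraD[OF \<mu>]
  interpret prob_space \<mu> by (rule s(1))
  show ?thesis unfolding kernel_op_def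
  proof (rule integral_bind[OF bounded_functions_measurable[OF f] C])
    show "P \<in> \<mu> \<rightarrow>\<^sub>M subprob_algebra S"
      using measurable_prob_algebraD[OF P] s(2) by (simp cong: measurable_cong_sets)
    show "finite_measure \<mu>" by (rule finite_measure_axioms)
    show "AE x in \<mu>. emeasure (P x) (space (P x)) \<le> ennreal 1"
      using prob_algebraD(1)[OF kernel_in_prob_algebra[OF P]] s(3)
      by (intro AE_I2) (auto simp: prob_space.emeasure_space_1)
  qed
qed

lemma bind_in_prob_algebra:
  assumes "\<mu> \<in> space (prob_algebra S)" "P \<in> S \<rightarrow>\<^sub>M prob_algebra S"
  shows "\<mu> \<bind> P \<in> space (prob_algebra S)"
  using prob_space_bind'[OF assms] sets_bind'[OF assms] by (simp add: space_prob_algebra)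

lemma law_at_0: "law_at P 0 \<mu> = \<mu>"
  by (simp add: law_at_def)

lemma law_at_Suc: "law_at P (Suc n) \<mu> = law_at P n \<mu> \<bind> P"
  by (simp add: law_at_def)

lemma law_at_in_prob_algebra:
  assumes "\<mu> \<in> space (prob_algebra S)" "P \<in> S \<rightarrow>\<^sub>M prob_algebra S"
  shows "law_at P n \<mu> \<in> space (prob_algebra S)"
  using assms by (induction n) (auto simp: law_at_0 law_at_Suc intro: bind_in_prob_algebra)

lemma measure_law_at_Suc:
  assumes P: "P \<in> S \<rightarrow>\<^sub>M prob_algebra S" and \<rho>: "\<rho> \<in> space (prob_algebra S)" and B: "B \<in> sets S"
  shows "measure (law_at P (Suc n) \<rho>) B = (\<integral>x. kernel_op P (indicat_real B) x \<partial>law_at P n \<rho>)"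
proof -
  note l = law_at_in_prob_algebra[OF \<rho> P]
  have "measure (law_at P (Suc n) \<rho>) B = (\<integral>x. indicat_real B x \<partial>law_at P (Suc n) \<rho>)"
    using sets.sets_into_space[OF B] by (simp add: prob_algebraD(3)[OF l] Int_absorb2)
  also have "\<dots> = (\<integral>x. kernel_op P (indicat_real B) x \<partial>law_at P n \<rho>)"
    unfolding law_at_Suc by (rule integral_bind_kernel[OF P l bounded_functions_indicator[OF B]])
  finally show ?thesis .
qed

lemma measure_law_at_Suc_kernel:
  assumes P: "P \<in> S \<rightarrow>\<^sub>M prob_algebra S" and \<rho>: "\<rho> \<in> space (prob_algebra S)" and B: "B \<in> sets S"
  shows "measure (law_at P (Suc n) \<rho>) B = (\<integral>x. measure (P x) B \<partial>law_at P n \<rho>)"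
  unfolding measure_law_at_Suc[OF assms]
  by (rule Bochner_Integration.integral_cong)
    (simp_all add: prob_algebraD(3)[OF law_at_in_prob_algebra[OF \<rho> P]] kernel_op_indicator[OF P B])

lemma measurable_kernel_measure:
  assumes "P \<in> S \<rightarrow>\<^sub>M prob_algebra S" "B \<in> sets S"
  shows "(\<lambda>x. measure (P x) B) \<in> borel_measurable S"
  using assms(2) by (rule measurable_compose[OF assms(1) measurable_measure_prob_algebra])

section \<open>The transition operator of a reversible kernel\<close>

locale reversible_kernel =
  fixes S :: "'a measure" and P :: "'a \<Rightarrow> 'a measure" and \<pi> :: "'a measure"
  assumes kernel: "P \<in> S \<rightarrow>\<^sub>M prob_algebra S"
    and pi: "\<pi> \<in> space (prob_algebra S)"
    and rev: "reversible S P \<pi>"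
begin

sublocale pi: prob_space \<pi>
  using pi by (simp add: space_prob_algebra)

lemma sets_pi [measurable_cong, simp]: "sets \<pi> = sets S"
  using pi by (simp add: space_prob_algebra)

lemma space_pi [simp]: "space \<pi> = space S"
  by (rule sets_eq_imp_space_eq) simp

abbreviation V where "V \<equiv> bounded_functions S"

abbreviation A where "A \<equiv> kernel_op P"

definition ip :: "('a \<Rightarrow> real) \<Rightarrow> ('a \<Rightarrow> real) \<Rightarrow> real" where
  "ip f g = (\<integral>x. f x * g x \<partial>\<pi>)"

lemma integrable_V: "f \<in> V \<Longrightarrow> integrable \<pi> f"
  by (rule integrable_bounded_functions[OF pi])

lemma A_V: "f \<in> V \<Longrightarrow> A f \<in> V"
  by (rule kernel_op_bounded_functions[OF kernel])

lemma integrable_mult_V: "f \<in> V \<Longrightarrow> g \<in> V \<Longrightarrow> integrable \<pi> (\<lambda>x. f x * g x)"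
  by (intro integrable_V bounded_functions_mult)

lemma A_diff:
  assumes "f \<in> V" "g \<in> V" "x \<in> space S"
  shows "A (\<lambda>y. f y - g y) x = A f x - A g x"
  using integrable_bounded_functions[OF kernel_in_prob_algebra[OF kernel assms(3)]] assms
  by (simp add: kernel_op_def)

lemma A_cmult: "A (\<lambda>y. c * f y) x = c * A f x"
  by (simp add: kernel_op_def)

lemma A_const: "x \<in> space S \<Longrightarrow> A (\<lambda>y. c) x = c"
  using kernel_in_prob_algebra[OF kernel, of x]
  by (simp add: kernel_op_def space_prob_algebra prob_space.prob_space)

lemma ip_cong: "(\<And>x. x \<in> space S \<Longrightarrow> f x = f' x) \<Longrightarrow> (\<And>x. x \<in> space S \<Longrightarrow> g x = g' x) \<Longrightarrow> ip f g = ip f' g'"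
  unfolding ip_def by (intro Bochner_Integration.integral_cong) auto

lemma ip_commute: "ip f g = ip g f"
  by (simp add: ip_def mult.commute)

lemma ip_diff_left: "f \<in> V \<Longrightarrow> g \<in> V \<Longrightarrow> h \<in> V \<Longrightarrow> ip (\<lambda>x. f x - g x) h = ip f h - ip g h"
  using integrable_mult_V by (simp add: ip_def left_diff_distrib)

lemma ip_diff_right: "f \<in> V \<Longrightarrow> g \<in> V \<Longrightarrow> h \<in> V \<Longrightarrow> ip h (\<lambda>x. f x - g x) = ip h f - ip h g"
  using integrable_mult_V by (simp add: ip_def right_diff_distrib)

lemma ip_cmult_left: "ip (\<lambda>x. c * f x) g = c * ip f g"
  by (simp add: ip_def mult.assoc)

lemma ip_cmult_right: "ip f (\<lambda>x. c * g x) = c * ip f g"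
  by (simp add: ip_def mult.left_commute)

lemma ip_self_nonneg: "0 \<le> ip f f"
  unfolding ip_def by (rule integral_nonneg_AE) auto

text \<open>Both sides are the integral of \<open>g(x) f(y)\<close>, one against \<open>\<pi>(dx) P(x,dy)\<close> and the other against
\<open>\<pi>(dy) P(y,dx)\<close>.\<close>

lemma self_adjoint:
  assumes f: "f \<in> V" and g: "g \<in> V"
  shows "ip (A f) g = ip f (A g)"
proof -
  \<comment> \<open>\<open>G\<close> is the pairing \<open>(x, y)\<close> or its flip: this covers both measures in the definition of
    reversibility.\<close>
  let ?J = "\<lambda>G. \<pi> \<bind> (\<lambda>x. P x \<bind> (\<lambda>y. return (S \<Otimes>\<^sub>M S) (G x y)))"
  obtain C where C: "\<And>x. x \<in> space S \<Longrightarrow> \<bar>f x\<bar> \<le> C" using f by (auto simp: bounded_functions_def)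
  obtain D where D: "\<And>x. x \<in> space S \<Longrightarrow> \<bar>g x\<bar> \<le> D" using g by (auto simp: bounded_functions_def)
  note [measurable] = measurable_prob_algebraD[OF kernel] bounded_functions_measurable[OF f]
    bounded_functions_measurable[OF g]
  let ?F = "\<lambda>z. g (fst z) * f (snd z)"
  have F: "\<bar>?F z\<bar> \<le> D * C" if "z \<in> space (S \<Otimes>\<^sub>M S)" for z
    unfolding abs_mult using that C D
    by (intro mult_mono) (auto simp: space_pair_measure intro: order_trans[OF abs_ge_zero])
  have J: "(\<integral>z. ?F z \<partial>?J G) = (\<integral>x. \<integral>y. ?F (G x y) \<partial>P x \<partial>\<pi>)"
    if G[measurable]: "case_prod G \<in> S \<Otimes>\<^sub>M S \<rightarrow>\<^sub>M S \<Otimes>\<^sub>M S" for G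
  proof -
    have Gx: "G x \<in> S \<rightarrow>\<^sub>M S \<Otimes>\<^sub>M S" if "x \<in> space S" for x
      using measurable_compose[OF measurable_Pair1'[OF that] G] by simp
    have K: "(\<lambda>x. P x \<bind> (\<lambda>y. return (S \<Otimes>\<^sub>M S) (G x y))) \<in> S \<rightarrow>\<^sub>M subprob_algebra (S \<Otimes>\<^sub>M S)"
      by (rule measurable_bind'[OF measurable_prob_algebraD[OF kernel]]) measurable
    have b: "P x \<bind> (\<lambda>y. return (S \<Otimes>\<^sub>M S) (G x y)) = distr (P x) (S \<Otimes>\<^sub>M S) (G x)"
      if "x \<in> space S" for x
      using kernel_in_prob_algebra[OF kernel that] Gx[OF that]
      by (intro bind_return_distr') (auto simp: space_prob_algebra prob_space.not_empty
          cong: measurable_cong_sets)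
    have "(\<integral>z. ?F z \<partial>?J G) = (\<integral>x. \<integral>z. ?F z \<partial>(P x \<bind> (\<lambda>y. return (S \<Otimes>\<^sub>M S) (G x y))) \<partial>\<pi>)"
    proof (rule integral_bind[where B="D * C" and B'=1 and K="S \<Otimes>\<^sub>M S"])
      show "?F \<in> borel_measurable (S \<Otimes>\<^sub>M S)" by measurable
      show "(\<lambda>x. P x \<bind> (\<lambda>y. return (S \<Otimes>\<^sub>M S) (G x y))) \<in> \<pi> \<rightarrow>\<^sub>M subprob_algebra (S \<Otimes>\<^sub>M S)"
        using K by (simp cong: measurable_cong_sets)
      show "finite_measure \<pi>" by (rule pi.finite_measure_axioms)
      show "AE x in \<pi>. emeasure (P x \<bind> (\<lambda>y. return (S \<Otimes>\<^sub>M S) (G x y)))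
          (space (P x \<bind> (\<lambda>y. return (S \<Otimes>\<^sub>M S) (G x y)))) \<le> ennreal 1"
        using subprob_space_kernel[OF K] by (intro AE_I2) (auto simp: subprob_space.emeasure_space_le_1)
    qed (use F in auto)
    also have "\<dots> = (\<integral>x. \<integral>y. ?F (G x y) \<partial>P x \<partial>\<pi>)"
    proof (rule Bochner_Integration.integral_cong[OF refl])
      fix x assume "x \<in> space \<pi>"
      then have x: "x \<in> space S" by simp
      have s: "sets (P x) = sets S"
        using kernel_in_prob_algebra[OF kernel x] by (simp add: space_prob_algebra)
      show "(\<integral>z. ?F z \<partial>(P x \<bind> (\<lambda>y. return (S \<Otimes>\<^sub>M S) (G x y)))) = (\<integral>y. ?F (G x y) \<partial>P x)"
        unfolding b[OF x] using Gx[OF x] s by (intro integral_distr) (auto cong: measurable_cong_sets)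
    qed
    finally show ?thesis .
  qed
  have "ip (A f) g = (\<integral>z. ?F z \<partial>?J (\<lambda>x y. (x, y)))"
    by (subst J) (simp_all add: ip_def kernel_op_def mult.commute)
  also have "\<dots> = (\<integral>z. ?F z \<partial>?J (\<lambda>y x. (x, y)))"
    using rev by (simp add: reversible_def)
  also have "\<dots> = ip f (A g)"
    by (subst J) (simp_all add: ip_def kernel_op_def mult.commute)
  finally show ?thesis .
qed

lemma ip_A_funpow:
  assumes "f \<in> V" "g \<in> V"
  shows "(A ^^ n) f \<in> V" "ip ((A ^^ n) f) g = ip f ((A ^^ n) g)"
proof -
  show V: "(A ^^ n) f \<in> V" for n by (induction n) (auto intro: A_V assms)
  show "ip ((A ^^ n) f) g = ip f ((A ^^ n) g)"
    using assms(2)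
  proof (induction n arbitrary: g)
    case (Suc n)
    have "ip ((A ^^ Suc n) f) g = ip ((A ^^ n) f) (A g)" by (simp add: self_adjoint V Suc.prems)
    also have "\<dots> = ip f ((A ^^ n) (A g))" using Suc by (simp add: A_V)
    finally show ?case by (simp add: funpow_swap1)
  qed simp
qed

lemma integral_A:
  assumes "f \<in> V"
  shows "(\<integral>x. A f x \<partial>\<pi>) = (\<integral>x. f x \<partial>\<pi>)"
proof -
  have "ip (A f) (\<lambda>x. 1) = ip f (A (\<lambda>x. 1))"
    by (rule self_adjoint[OF assms bounded_functions_const])
  also have "\<dots> = ip f (\<lambda>x. 1)" by (rule ip_cong) (auto simp: A_const)
  finally show ?thesis by (simp add: ip_def)
qed

lemma stationary_pi: "\<pi> \<bind> P = \<pi>"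
proof (rule measure_eqI)
  have p: "\<pi> \<bind> P \<in> space (prob_algebra S)" by (rule bind_in_prob_algebra[OF pi kernel])
  then interpret b: prob_space "\<pi> \<bind> P" by (simp add: space_prob_algebra)
  show s: "sets (\<pi> \<bind> P) = sets \<pi>" using p by (simp add: space_prob_algebra)
  fix B assume "B \<in> sets (\<pi> \<bind> P)"
  then have B: "B \<in> sets S" using s by simp
  have "(\<integral>x. indicat_real B x \<partial>(\<pi> \<bind> P)) = (\<integral>x. indicat_real B x \<partial>\<pi>)"
    unfolding integral_bind_kernel[OF kernel pi bounded_functions_indicator[OF B]]
    by (rule integral_A[OF bounded_functions_indicator[OF B]])
  then have "measure (\<pi> \<bind> P) B = measure \<pi> B"
    using sets.sets_into_space[OF B] by (simp add: sets_eq_imp_space_eq[OF s] Int_absorb2)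
  then show "emeasure (\<pi> \<bind> P) B = emeasure \<pi> B"
    by (simp add: b.emeasure_eq_measure pi.emeasure_eq_measure)
qed

text \<open>Jensen's inequality \<open>(Pf)\<^sup>2 \<le> P(f\<^sup>2)\<close>, integrated against the stationary measure.\<close>

lemma A_contraction:
  assumes f: "f \<in> V"
  shows "ip (A f) (A f) \<le> ip f f"
proof -
  have "ip (A f) (A f) \<le> (\<integral>x. A (\<lambda>y. f y * f y) x \<partial>\<pi>)"
    unfolding ip_def
  proof (rule integral_mono)
    fix x assume "x \<in> space \<pi>"
    then have Px: "P x \<in> space (prob_algebra S)" by (simp add: kernel_in_prob_algebra[OF kernel])
    then interpret p: prob_space "P x" by (simp add: space_prob_algebra)
    have "0 \<le> p.variance f" by (rule p.variance_positive)
    also have "\<dots> = (\<integral>y. (f y)\<^sup>2 \<partial>P x) - (\<integral>y. f y \<partial>P x)\<^sup>2"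
      using f by (intro p.variance_eq integrable_bounded_functions[OF Px])
        (auto simp: power2_eq_square intro: bounded_functions_mult)
    finally show "A f x * A f x \<le> A (\<lambda>y. f y * f y) x"
      by (simp add: kernel_op_def power2_eq_square)
  qed (auto intro!: integrable_V A_V bounded_functions_mult f)
  also have "\<dots> = ip f f" by (simp add: integral_A bounded_functions_mult f ip_def)
  finally show ?thesis .
qed

lemma abs_ip_A_le:
  assumes f: "f \<in> V"
  shows "\<bar>ip (A f) f\<bar> \<le> ip f f"
proof -
  have Af: "A f \<in> V" by (rule A_V[OF f])
  have "2 * \<bar>ip (A f) f\<bar> \<le> (\<integral>x. 2 * \<bar>A f x * f x\<bar> \<partial>\<pi>)"
    unfolding ip_def by simp
  also have "\<dots> \<le> (\<integral>x. A f x * A f x + f x * f x \<partial>\<pi>)"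
  proof (rule integral_mono)
    show "2 * \<bar>A f x * f x\<bar> \<le> A f x * A f x + f x * f x" for x
      using sum_squares_bound[of "\<bar>A f x\<bar>" "\<bar>f x\<bar>"] by (simp add: abs_mult power2_eq_square)
  qed (use f Af integrable_mult_V in auto)
  also have "\<dots> = ip (A f) (A f) + ip f f"
    using f Af integrable_mult_V by (simp add: ip_def)
  also have "\<dots> \<le> 2 * ip f f" using A_contraction[OF f] by simp
  finally show ?thesis by simp
qed

text \<open>If the form \<open>\<langle>(A - m)f, f\<rangle>\<close> is nonnegative, then a function at which it is small is almost an
eigenfunction: \<open>f\<close> cannot be improved much by a step in the direction of the gradient \<open>r\<close>, because
the form is bounded by \<open>1 - m\<close>, and therefore \<open>r\<close> is small.\<close>

lemma residual_bound:
  assumes f: "f \<in> V" and m: "m < 1" and lower: "\<And>g. g \<in> V \<Longrightarrow> m * ip g g \<le> ip (A g) g"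
  defines "r \<equiv> \<lambda>x. m * f x - A f x"
  shows "ip r r \<le> (1 - m) * (ip (A f) f - m * ip f f)"
proof -
  have r: "r \<in> V" unfolding r_def by (intro bounded_functions_intros A_V f)
  define s where "s = 1 / (1 - m)"
  have s: "0 < s" "s * (1 - m) = 1" using m by (auto simp: s_def)
  define u where "u = (\<lambda>x. (- s) * r x)"
  have u: "u \<in> V" unfolding u_def by (intro bounded_functions_intros r)
  \<comment> \<open>The form of \<open>A - m\<close> is nonnegative at \<open>f + s r\<close>; the step \<open>s\<close> minimises the resulting bound.\<close>
  define g where "g = (\<lambda>x. f x - u x)"
  have g: "g \<in> V" unfolding g_def by (intro bounded_functions_intros f u)
  have "ip (A g) g = ip (\<lambda>x. A f x - A u x) g"
    by (rule ip_cong) (simp_all add: g_def A_diff f u)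
  also have "\<dots> = ip (A f) f - 2 * ip (A f) u + ip (A u) u"
    unfolding g_def using self_adjoint[OF f u] ip_commute[of f "A u"]
    by (simp add: ip_diff_left ip_diff_right f u A_V bounded_functions_diff)
  also have "ip (A u) u = ip (\<lambda>x. (- s) * A r x) u"
    by (rule ip_cong) (simp_all only: u_def A_cmult)
  finally have e1: "ip (A g) g = ip (A f) f + 2 * s * ip (A f) r + s * s * ip (A r) r"
    unfolding u_def ip_cmult_left ip_cmult_right by (simp add: mult.assoc)
  have "ip g g = ip f f - 2 * ip f u + ip u u"
    unfolding g_def using ip_commute[of f u]
    by (simp add: ip_diff_left ip_diff_right f u bounded_functions_diff)
  then have e2: "ip g g = ip f f + 2 * s * ip f r + s * s * ip r r"
    unfolding u_def ip_cmult_left ip_cmult_right by (simp add: mult.assoc)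
  have e3: "ip r r = m * ip f r - ip (A f) r"
    by (subst (1) r_def) (simp add: ip_diff_left ip_cmult_left f r A_V bounded_functions_cmult)
  have "0 \<le> ip (A g) g - m * ip g g" using lower[OF g] by simp
  also have "\<dots> = (ip (A f) f - m * ip f f) - 2 * s * ip r r + s * s * (ip (A r) r - m * ip r r)"
    unfolding e1 e2 e3 by (simp add: algebra_simps)
  also have "\<dots> \<le> (ip (A f) f - m * ip f f) - 2 * s * ip r r + s * s * ((1 - m) * ip r r)"
    using abs_ip_A_le[OF r] by (intro add_left_mono mult_left_mono) (auto simp: algebra_simps)
  also have "\<dots> = (ip (A f) f - m * ip f f) - s * ip r r"
  proof -
    have "s * s * ((1 - m) * ip r r) = s * (s * (1 - m)) * ip r r" by (simp only: mult_ac)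
    then show ?thesis using s(2) by simp
  qed
  finally have step: "s * ip r r \<le> ip (A f) f - m * ip f f" by simp
  have "ip r r = (s * (1 - m)) * ip r r" by (simp only: s(2) mult_1_left)
  also have "\<dots> = (1 - m) * (s * ip r r)" by (simp only: mult_ac)
  also have "\<dots> \<le> (1 - m) * (ip (A f) f - m * ip f f)"
    using m step by (intro mult_left_mono) auto
  finally show ?thesis .
qed

lemma V_subset_L2:
  assumes "f \<in> V"
  shows "f \<in> L2_space \<pi>"
  unfolding L2_space_def power2_eq_square
  using bounded_functions_measurable[OF assms] integrable_mult_V[OF assms assms]
  by (simp add: measurable_cong_sets[OF sets_pi refl])

lemma L2_norm_sq: "(L2_norm \<pi> f)\<^sup>2 = ip f f"
proof -
  have "L2_norm \<pi> f = sqrt (ip f f)"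
    unfolding L2_norm_def ip_def by (simp only: power2_eq_square)
  then show ?thesis using ip_self_nonneg[of f] by simp
qed

text \<open>The spectral theorem is avoided by looking at the bottom \<open>m\<close> of the numerical range.  If \<open>m\<close> were
negative, it would lie outside the spectrum, and boundedness of the resolvent at \<open>m\<close> would give
\<open>\<parallel>f\<parallel> \<le> K \<parallel>(m - A)f\<parallel>\<close>.  With the residual bound this says that \<open>m + \<epsilon>\<close> is still a lower bound for the
numerical range, where \<open>\<epsilon> = 1 / (K\<^sup>2 (1 - m))\<close>.\<close>

lemma ip_A_nonneg:
  assumes nonneg: "nonneg_eigenvalues P \<pi>" and f: "f \<in> V"
  shows "0 \<le> ip (A f) f"
proof -
  define \<Lambda> where "\<Lambda> = {c. \<forall>g\<in>V. c * ip g g \<le> ip (A g) g}"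
  define m where "m = Sup \<Lambda>"
  have "-1 * ip g g \<le> ip (A g) g" if "g \<in> V" for g
    using abs_ip_A_le[OF that] by (simp add: abs_le_iff)
  then have "-1 \<in> \<Lambda>" by (simp add: \<Lambda>_def)
  have "c \<le> 1" if "c \<in> \<Lambda>" for c
  proof -
    have "c * ip (\<lambda>x. 1) (\<lambda>x. 1) \<le> ip (A (\<lambda>x. 1)) (\<lambda>x. 1)"
      using that bounded_functions_const by (auto simp: \<Lambda>_def)
    also have "\<dots> = ip (\<lambda>x. 1) (\<lambda>x. 1)" by (rule ip_cong) (auto simp: A_const)
    finally show ?thesis using pi.prob_space by (simp add: ip_def)
  qed
  then have bdd: "bdd_above \<Lambda>" by (meson bdd_aboveI)
  have lower: "m * ip g g \<le> ip (A g) g" if g: "g \<in> V" for g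
  proof (cases "ip g g = 0")
    case True
    then show ?thesis using \<open>-1 \<in> \<Lambda>\<close> g by (auto simp: \<Lambda>_def)
  next
    case False
    then have pos: "0 < ip g g" using ip_self_nonneg[of g] by simp
    have "m \<le> ip (A g) g / ip g g"
      unfolding m_def
    proof (rule cSup_least)
      show "\<Lambda> \<noteq> {}" using \<open>-1 \<in> \<Lambda>\<close> by auto
    qed (use pos g in \<open>auto simp: \<Lambda>_def pos_le_divide_eq\<close>)
    then show ?thesis using pos by (simp add: pos_le_divide_eq)
  qed
  have "0 \<le> m"
  proof (rule ccontr)
    assume "\<not> 0 \<le> m"
    then have m: "m < 0" by simp
    then have "m \<notin> L2_spectrum \<pi> A" using nonneg by (auto simp: nonneg_eigenvalues_def)
    then obtain R where R: "L2_bounded_linear \<pi> R"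
        "\<And>g. g \<in> L2_space \<pi> \<Longrightarrow> AE x in \<pi>. R (\<lambda>y. m * g y - A g y) x = g x"
      by (auto simp: L2_spectrum_def)
    obtain K0 where K0: "\<forall>g\<in>L2_space \<pi>. L2_norm \<pi> (R g) \<le> K0 * L2_norm \<pi> g"
      using R(1) unfolding L2_bounded_linear_def by blast
    define K where "K = max K0 1"
    have K: "1 \<le> K" "K0 \<le> K" by (auto simp: K_def)
    define \<epsilon> where "\<epsilon> = 1 / (K\<^sup>2 * (1 - m))"
    have eps: "0 < \<epsilon>" using K m by (auto simp: \<epsilon>_def)
    have "m + \<epsilon> \<in> \<Lambda>"
      unfolding \<Lambda>_def
    proof safe
      fix g assume g: "g \<in> V"
      define r where "r = (\<lambda>x. m * g x - A g x)"
      have r: "r \<in> V" unfolding r_def by (intro bounded_functions_intros A_V g)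
      have Rr: "R r \<in> L2_space \<pi>" using R(1) V_subset_L2[OF r] by (auto simp: L2_bounded_linear_def)
      have "ip (R r) (R r) = ip g g"
        unfolding ip_def
      proof (rule integral_cong_AE)
        show "AE x in \<pi>. R r x * R r x = g x * g x"
          using R(2)[OF V_subset_L2[OF g]] by (auto simp: r_def)
      qed (use Rr V_subset_L2[OF g] in \<open>auto simp: L2_space_def\<close>)
      then have "ip g g = (L2_norm \<pi> (R r))\<^sup>2" by (simp add: L2_norm_sq)
      also have "\<dots> \<le> (K * L2_norm \<pi> r)\<^sup>2"
      proof (rule power_mono)
        have "0 \<le> L2_norm \<pi> r" unfolding L2_norm_def by (simp add: integral_nonneg_AE)
        then show "L2_norm \<pi> (R r) \<le> K * L2_norm \<pi> r"
          using bspec[OF K0 V_subset_L2[OF r]] K(2) by (meson mult_right_mono order_trans)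
      qed (simp add: L2_norm_def integral_nonneg_AE)
      also have "\<dots> = K\<^sup>2 * ip r r" by (simp add: power_mult_distrib L2_norm_sq)
      also have "\<dots> \<le> K\<^sup>2 * ((1 - m) * (ip (A g) g - m * ip g g))"
        using residual_bound[OF g _ lower] m by (intro mult_left_mono) (auto simp: r_def)
      finally have "ip g g \<le> (K\<^sup>2 * (1 - m)) * (ip (A g) g - m * ip g g)" by (simp add: mult.assoc)
      then have "\<epsilon> * ip g g \<le> ip (A g) g - m * ip g g"
        using K m by (simp add: \<epsilon>_def pos_divide_le_eq mult.commute)
      then show "(m + \<epsilon>) * ip g g \<le> ip (A g) g" by (simp add: algebra_simps)
    qed
    then have "m + \<epsilon> \<le> m" unfolding m_def by (rule cSup_upper[OF _ bdd])
    with eps show False by simp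
  qed
  then show ?thesis
    using lower[OF f] ip_self_nonneg[of f] by (meson mult_nonneg_nonneg order_trans)
qed

end

section \<open>Convolutions of real sequences\<close>

text \<open>The renewal equations below are identities between convolutions.  Their commutation rule is read off
from the commutative ring of formal power series.\<close>

definition conv :: "(nat \<Rightarrow> real) \<Rightarrow> (nat \<Rightarrow> real) \<Rightarrow> nat \<Rightarrow> real" where
  "conv s b n = (\<Sum>k\<le>n. s k * b (n - k))"

lemma conv_fps: "conv s b n = fps_nth (Abs_fps s * Abs_fps b) n"
  by (simp add: conv_def fps_mult_nth atLeast0AtMost)

lemma conv_left_commute: "conv s (conv r a) = conv r (conv s a)"
proof -
  have "Abs_fps (conv s b) = Abs_fps s * Abs_fps b" for s b
    by (rule fps_ext) (simp add: conv_fps)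
  then show ?thesis
    by (intro ext) (simp add: conv_fps mult.left_commute)
qed

text \<open>Averaging against a summable weight preserves limits, by Tannery's theorem.\<close>

lemma conv_tendsto:
  assumes s: "summable s" "\<And>n. 0 \<le> s n" and b: "b \<longlonglongrightarrow> \<beta>"
  shows "conv s b \<longlonglongrightarrow> suminf s * \<beta>"
proof -
  obtain B where B: "\<And>n. \<bar>b n\<bar> \<le> B"
    using convergent_imp_Bseq[OF convergentI[OF b]] by (auto simp: Bseq_def)
  define a where "a = (\<lambda>k n. if k \<le> n then s k * b (n - k) else 0)"
  have "(\<lambda>n. suminf (\<lambda>k. a k n)) \<longlonglongrightarrow> (\<Sum>k. s k * \<beta>)"
  proof (rule tannerys_theorem[THEN conjunct2, THEN conjunct2])
    show "a k \<longlonglongrightarrow> s k * \<beta>" for k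
    proof -
      have "(\<lambda>n. s k * b (n - k)) \<longlonglongrightarrow> s k * \<beta>"
        using LIMSEQ_offset[of "\<lambda>n. b (n - k)" k \<beta>] b by (intro tendsto_mult tendsto_const) simp
      moreover have "\<forall>\<^sub>F n in sequentially. s k * b (n - k) = a k n"
        using eventually_ge_at_top[of k] by eventually_elim (simp add: a_def)
      ultimately show ?thesis by (rule Lim_transform_eventually)
    qed
    show "\<forall>\<^sub>F (k, n) in at_top \<times>\<^sub>F sequentially. norm (a k n) \<le> s k * B"
      using s(2) B order_trans[OF abs_ge_zero B]
      by (intro always_eventually) (auto simp: a_def abs_mult intro!: mult_left_mono)
    show "summable (\<lambda>k. s k * B)" by (rule summable_mult2[OF s(1)])
  qed simp
  moreover have "suminf (\<lambda>k. a k n) = conv s b n" for n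
  proof -
    have "suminf (\<lambda>k. a k n) = (\<Sum>k\<le>n. a k n)" by (rule suminf_finite) (auto simp: a_def)
    then show ?thesis by (simp add: a_def conv_def)
  qed
  ultimately show ?thesis by (simp add: suminf_mult2[OF s(1)])
qed

text \<open>Convolving the first sequence with \<open>s\<close> and the second with \<open>r\<close> changes neither limit, and produces
the same sequence.  This compares the two limits although \<open>a\<close> itself may oscillate.\<close>

lemma conv_limits_agree:
  assumes "r sums 1" "\<And>n. 0 \<le> r n" "s sums 1" "\<And>n. 0 \<le> s n"
    and "conv r a \<longlonglongrightarrow> x" "conv s a \<longlonglongrightarrow> y"
  shows "x = y"
proof (rule LIMSEQ_unique)
  show "conv s (conv r a) \<longlonglongrightarrow> x"
    using conv_tendsto[of s "conv r a" x] assms by (simp add: sums_iff)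
  show "conv s (conv r a) \<longlonglongrightarrow> y"
    unfolding conv_left_commute[of s r]
    using conv_tendsto[of r "conv s a" y] assms by (simp add: sums_iff)
qed

text \<open>For \<open>q\<close> the law of a waiting time and \<open>Q\<close> its tail, \<open>Q * a\<close> has the increments \<open>a - q * a\<close>.  So it
increases, bounded by \<open>\<Sum>Q\<close>, to a limit \<open>L\<close>, which is identified by convolving with \<open>s\<close>:
\<open>L = lim s * (Q * a) = lim Q * (s * a) = (\<Sum>Q) y\<close>.\<close>

lemma conv_tail_le:
  assumes q: "q 0 = 0" "\<And>n. Q n = Q (Suc n) + q (Suc n)"
    and Q: "Q 0 = 1" "\<And>n. 0 \<le> Q n" "summable Q"
    and a: "\<And>n. 0 \<le> a n" "\<And>n. a n \<le> 1" "\<And>n. conv q a n \<le> a n"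
    and s: "s sums 1" "\<And>n. 0 \<le> s n" "conv s a \<longlonglongrightarrow> y"
  shows "conv Q a n \<le> suminf Q * y"
proof -
  have "conv Q a n \<le> conv Q a (Suc n)" for n
  proof -
    have "conv Q a (Suc n) = a (Suc n) + (\<Sum>k\<le>n. Q (Suc k) * a (n - k))"
      by (simp add: conv_def sum.atMost_Suc_shift Q(1) del: sum.atMost_Suc)
    moreover have "conv q a (Suc n) = (\<Sum>k\<le>n. q (Suc k) * a (n - k))"
      by (simp add: conv_def sum.atMost_Suc_shift q(1) del: sum.atMost_Suc)
    moreover have "conv Q a n = (\<Sum>k\<le>n. Q (Suc k) * a (n - k)) + (\<Sum>k\<le>n. q (Suc k) * a (n - k))"
      unfolding conv_def sum.distrib[symmetric] by (subst q(2)) (simp add: distrib_right)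
    ultimately show ?thesis using a(3)[of "Suc n"] by simp
  qed
  then have inc: "incseq (conv Q a)" by (rule incseq_SucI)
  have "conv Q a n \<le> suminf Q" for n
  proof -
    have "conv Q a n \<le> (\<Sum>k\<le>n. Q k)"
      unfolding conv_def using Q(2) a(1,2) by (intro sum_mono) (simp add: mult_left_le)
    also have "\<dots> \<le> suminf Q" using Q by (intro sum_le_suminf) auto
    finally show ?thesis .
  qed
  then obtain L where L: "conv Q a \<longlonglongrightarrow> L" "\<And>n. conv Q a n \<le> L"
    using incseq_convergent[OF inc, of "suminf Q"] by blast
  have "conv s (conv Q a) \<longlonglongrightarrow> L"
    using conv_tendsto[of s "conv Q a" L] s L(1) by (simp add: sums_iff)
  moreover have "conv s (conv Q a) \<longlonglongrightarrow> suminf Q * y"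
    unfolding conv_left_commute[of s Q] by (rule conv_tendsto[OF Q(3,2) s(3)])
  ultimately have "L = suminf Q * y" by (rule LIMSEQ_unique)
  then show ?thesis using L(2) by simp
qed

section \<open>Markov chains stopped at randomized stopping times\<close>

text \<open>The image of the measure \<open>Z1 dM1\<close> under \<open>Y1\<close> is determined by its values on sets.  This passes from
indicators to general integrands, and is used to compare \<open>X n\<close> under different weights and on
different spaces.\<close>

lemma integral_weighted_eq:
  fixes Z1 :: "'v \<Rightarrow> real" and Z2 :: "'w \<Rightarrow> real" and g :: "'a \<Rightarrow> real"
  assumes Y [measurable]: "Y1 \<in> M1 \<rightarrow>\<^sub>M S" "Y2 \<in> M2 \<rightarrow>\<^sub>M S"
    and Z: "integrable M1 Z1" "integrable M2 Z2" "AE x in M1. 0 \<le> Z1 x" "AE x in M2. 0 \<le> Z2 x"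
    and eq: "\<And>A. A \<in> sets S \<Longrightarrow>
      (\<integral>x. Z1 x * indicat_real A (Y1 x) \<partial>M1) = (\<integral>x. Z2 x * indicat_real A (Y2 x) \<partial>M2)"
    and g [measurable]: "g \<in> borel_measurable S"
  shows "(\<integral>x. Z1 x * g (Y1 x) \<partial>M1) = (\<integral>x. Z2 x * g (Y2 x) \<partial>M2)"
proof -
  have int: "(\<integral>x. g x \<partial>distr (density M (\<lambda>x. ennreal (Z x))) S Y) = (\<integral>x. Z x * g (Y x) \<partial>M)"
    if [measurable]: "Y \<in> M \<rightarrow>\<^sub>M S" "integrable M Z" and "AE x in M. 0 \<le> Z x"
    for M :: "'u measure" and Y and Z :: "'u \<Rightarrow> real"
    using that by (subst integral_distr) (simp_all add: integral_density)
  have em: "emeasure (distr (density M (\<lambda>x. ennreal (Z x))) S Y) A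
      = ennreal (\<integral>x. Z x * indicat_real A (Y x) \<partial>M)"
    if [measurable]: "Y \<in> M \<rightarrow>\<^sub>M S" "A \<in> sets S" and Z: "integrable M Z" "AE x in M. 0 \<le> Z x"
    for M :: "'u measure" and Y and Z :: "'u \<Rightarrow> real" and A
  proof -
    note [measurable] = borel_measurable_integrable[OF Z(1)]
    have i: "integrable M (\<lambda>x. Z x * indicat_real A (Y x))"
      using Z(1) by (rule Bochner_Integration.integrable_bound)
        (auto simp: indicator_def)
    have "emeasure (distr (density M (\<lambda>x. ennreal (Z x))) S Y) A
        = (\<integral>\<^sup>+x. ennreal (Z x * indicat_real A (Y x)) \<partial>M)"
      by (subst emeasure_distr, simp, simp, subst emeasure_density)
        (auto intro!: nn_integral_cong simp: indicator_def)
    also have "\<dots> = ennreal (\<integral>x. Z x * indicat_real A (Y x) \<partial>M)"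
      by (rule nn_integral_eq_integral[OF i]) (use Z(2) in \<open>auto simp: indicator_def\<close>)
    finally show ?thesis .
  qed
  have "distr (density M1 (\<lambda>x. ennreal (Z1 x))) S Y1 = distr (density M2 (\<lambda>x. ennreal (Z2 x))) S Y2"
    by (rule measure_eqI) (simp_all add: em[OF Y(1) _ Z(1,3)] em[OF Y(2) _ Z(2,4)] eq)
  then show ?thesis using int[OF Y(1) Z(1,3)] int[OF Y(2) Z(2,4)] by simp
qed

locale chain_with_random_time = prob_space Q for Q :: "'w measure" +
  fixes S :: "'a measure" and P :: "'a \<Rightarrow> 'a measure" and \<mu> :: "'a measure"
    and X :: "nat \<Rightarrow> 'w \<Rightarrow> 'a" and T :: "'w \<Rightarrow> enat"
  assumes kernel: "P \<in> S \<rightarrow>\<^sub>M prob_algebra S"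
    and initial: "\<mu> \<in> space (prob_algebra S)"
    and chain: "markov_chain S P \<mu> Q X"
    and time: "randomized_stopping_time S Q X T"
begin

lemma X_measurable [measurable]: "X n \<in> Q \<rightarrow>\<^sub>M S"
  using chain by (simp add: markov_chain_def)

lemma T_measurable [measurable]: "T \<in> Q \<rightarrow>\<^sub>M count_space UNIV"
  using time by (simp add: randomized_stopping_time_def)

lemma X_history:
  assumes "i \<le> n"
  shows "X i \<in> history Q S X n \<rightarrow>\<^sub>M S"
proof -
  have "(\<lambda>\<omega>. \<lambda>i\<in>{..n}. X i \<omega>) \<in> history Q S X n \<rightarrow>\<^sub>M (\<Pi>\<^sub>M i\<in>{..n}. S)"
    unfolding history_def
    by (rule measurable_vimage_algebra1)
      (auto simp: space_PiM PiE_iff intro: measurable_space[OF X_measurable] split: if_splits)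
  from measurable_compose[OF this measurable_component_singleton[of i]] assms
  show ?thesis by simp
qed

lemma space_history [simp]: "space (history Q S X n) = space Q"
  by (simp add: history_def)

lemma sets_history_subset:
  assumes "space N = space Q" "\<And>i. i \<le> n \<Longrightarrow> X i \<in> N \<rightarrow>\<^sub>M S"
  shows "sets (history Q S X n) \<subseteq> sets N"
  unfolding history_def
  by (rule sets_image_in_sets[OF assms(1)], rule measurable_restrict, use assms(2) in auto)

lemma subalgebra_history: "subalgebra Q (history Q S X n)"
  unfolding subalgebra_def using sets_history_subset[of Q n] by simp

lemma subalgebra_history_mono: "m \<le> n \<Longrightarrow> subalgebra (history Q S X n) (history Q S X m)"
  unfolding subalgebra_def
  using sets_history_subset[of "history Q S X n" m] X_history[of _ n] by simp

lemma sigma_finite_subalgebra_history: "sigma_finite_subalgebra Q (history Q S X n)"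
  by (rule finite_measure_subalgebra_is_sigma_finite)
    (intro finite_measure_subalgebra.intro finite_measure_subalgebra_axioms.intro
      finite_measure_axioms subalgebra_history)

definition stopped_at :: "nat \<Rightarrow> 'w set" where
  "stopped_at k = {\<omega> \<in> space Q. T \<omega> = enat k}"

lemma stopped_at_sets [measurable]: "stopped_at k \<in> sets Q"
  unfolding stopped_at_def by measurable

definition in_set :: "nat \<Rightarrow> 'a set \<Rightarrow> 'w set" where
  "in_set n A = {\<omega> \<in> space Q. X n \<omega> \<in> A}"

lemma in_set_sets [measurable]:
  assumes [measurable]: "A \<in> sets S"
  shows "in_set n A \<in> sets Q"
  unfolding in_set_def by measurable

text \<open>The Markov property, tested against a weight that is determined by the history.\<close>

lemma integral_step:
  assumes Z: "Z \<in> borel_measurable (history Q S X n)" "integrable Q Z" and A: "A \<in> sets S"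
  shows "(\<integral>\<omega>. Z \<omega> * indicat_real (in_set (Suc n) A) \<omega> \<partial>Q) = (\<integral>\<omega>. Z \<omega> * measure (P (X n \<omega>)) A \<partial>Q)"
proof -
  interpret sigma_finite_subalgebra Q "history Q S X n" by (rule sigma_finite_subalgebra_history)
  note [measurable] = borel_measurable_integrable[OF Z(2)] A measurable_prob_algebraD[OF kernel]
  have m: "(\<lambda>\<omega>. measure (P (X n \<omega>)) A) \<in> borel_measurable Q" by measurable
  have i: "integrable Q (\<lambda>\<omega>. Z \<omega> * indicat_real (in_set (Suc n) A) \<omega>)"
    using Z(2) by (rule Bochner_Integration.integrable_bound) (auto simp: indicator_def)
  have "(\<integral>\<omega>. Z \<omega> * indicat_real (in_set (Suc n) A) \<omega> \<partial>Q)
      = (\<integral>\<omega>. Z \<omega> * real_cond_exp Q (history Q S X n) (indicat_real (in_set (Suc n) A)) \<omega> \<partial>Q)"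
    using real_cond_exp_intg(2)[OF i Z(1)] by simp
  also have "\<dots> = (\<integral>\<omega>. Z \<omega> * measure (P (X n \<omega>)) A \<partial>Q)"
  proof (rule integral_cong_AE)
    have "AE \<omega> in Q. real_cond_exp Q (history Q S X n) (indicat_real (in_set (Suc n) A)) \<omega>
        = measure (P (X n \<omega>)) A"
      using chain A by (simp add: markov_chain_def in_set_def)
    then show "AE \<omega> in Q. Z \<omega> * real_cond_exp Q (history Q S X n) (indicat_real (in_set (Suc n) A)) \<omega>
        = Z \<omega> * measure (P (X n \<omega>)) A"
      by eventually_elim simp
  qed (use m in measurable)
  finally show ?thesis .
qed

text \<open>
  The conditional probability of \<open>{T = k}\<close> given \<open>X 0, \<dots>, X k\<close>.  The event itself may involve
  randomness outside the history, so the Markov property does not apply to its indicator; it does apply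
  to this weight, and for events of the chain from time \<open>k\<close> onwards both have the same integral.
\<close>

definition stop_weight :: "nat \<Rightarrow> 'w \<Rightarrow> real" where
  "stop_weight k = real_cond_exp Q (history Q S X k) (indicat_real (stopped_at k))"

lemma stop_weight:
  shows "stop_weight k \<in> borel_measurable (history Q S X k)" "integrable Q (stop_weight k)"
    "AE \<omega> in Q. 0 \<le> stop_weight k \<omega>"
proof -
  interpret sigma_finite_subalgebra Q "history Q S X k" by (rule sigma_finite_subalgebra_history)
  show "stop_weight k \<in> borel_measurable (history Q S X k)"
    unfolding stop_weight_def by simp
  show "integrable Q (stop_weight k)"
    unfolding stop_weight_def by (rule real_cond_exp_int) (simp add: emeasure_eq_measure)
  show "AE \<omega> in Q. 0 \<le> stop_weight k \<omega>"
    unfolding stop_weight_def by (rule real_cond_exp_pos) auto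
qed

text \<open>For \<open>n = k\<close> the event \<open>X n \<in> A\<close> belongs to the history, and for \<open>n > k\<close> it belongs to the future, where
conditional independence applies.\<close>

lemma prob_stopped_in_set:
  assumes kn: "k \<le> n" and A [measurable]: "A \<in> sets S"
  shows "prob (stopped_at k \<inter> in_set n A) = (\<integral>\<omega>. stop_weight k \<omega> * indicat_real A (X n \<omega>) \<partial>Q)"
proof -
  interpret sigma_finite_subalgebra Q "history Q S X k" by (rule sigma_finite_subalgebra_history)
  let ?E = "indicat_real (stopped_at k)" and ?B = "indicat_real (in_set n A)"
  let ?ce = "real_cond_exp Q (history Q S X k)"
  have ind: "?B \<omega> = indicat_real A (X n \<omega>)" if "\<omega> \<in> space Q" for \<omega>
    using that by (simp add: in_set_def indicator_def)
  have iEB: "integrable Q (indicat_real (stopped_at k \<inter> in_set n A))"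
    by (simp add: emeasure_eq_measure)
  have iZB: "integrable Q (\<lambda>\<omega>. stop_weight k \<omega> * ?B \<omega>)"
    using stop_weight(2)[of k] by (rule Bochner_Integration.integrable_bound)
      (use stop_weight(2)[of k] in \<open>auto simp: indicator_def\<close>)
  have "prob (stopped_at k \<inter> in_set n A) = (\<integral>\<omega>. indicat_real (stopped_at k \<inter> in_set n A) \<omega> \<partial>Q)"
    by simp
  also have "\<dots> = (\<integral>\<omega>. stop_weight k \<omega> * ?B \<omega> \<partial>Q)"
  proof (cases "n = k")
    case True
    have B: "?B \<in> borel_measurable (history Q S X k)"
      using measurable_sets[OF X_history[of k k] A] True
      by (intro borel_measurable_indicator) (simp add: in_set_def vimage_def Int_def conj_commute)
    have i: "integrable Q (\<lambda>\<omega>. ?B \<omega> * ?E \<omega>)"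
      using iEB by (rule Bochner_Integration.integrable_cong[THEN iffD1, rotated 2]) (auto simp: indicator_def)
    have "(\<integral>\<omega>. ?B \<omega> * ?ce ?E \<omega> \<partial>Q) = (\<integral>\<omega>. ?B \<omega> * ?E \<omega> \<partial>Q)"
      by (rule real_cond_exp_intg(2)[OF i B]) simp
    then show ?thesis by (simp add: stop_weight_def indicator_inter_arith mult.commute)
  next
    case False
    with kn obtain j where n: "n = k + 1 + j"
      using less_imp_Suc_add[of k n] by auto
    \<comment> \<open>the future trajectory starts at time \<open>k + 1\<close>, so that \<open>X n\<close> is its coordinate \<open>j\<close>\<close>
    let ?F = "{x \<in> space (\<Pi>\<^sub>M k\<in>(UNIV :: nat set). S). x j \<in> A}"
    have F: "?F \<in> sets (\<Pi>\<^sub>M k\<in>(UNIV :: nat set). S)" by measurable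
    have "{\<omega> \<in> space Q. (\<lambda>i. X (k + 1 + i) \<omega>) \<in> ?F} = in_set n A"
      using measurable_space[OF X_measurable] by (auto simp: in_set_def space_PiM n)
    with bspec[OF spec[OF conjunct2[OF time[unfolded randomized_stopping_time_def]], of k] F]
    have "cond_indep_events Q (history Q S X k) (stopped_at k) (in_set n A)"
      by (simp only: stopped_at_def)
    then have ae: "AE \<omega> in Q. ?ce (indicat_real (stopped_at k \<inter> in_set n A)) \<omega> = stop_weight k \<omega> * ?ce ?B \<omega>"
      by (simp add: cond_indep_events_def stop_weight_def)
    have "(\<integral>\<omega>. indicat_real (stopped_at k \<inter> in_set n A) \<omega> \<partial>Q)
        = (\<integral>\<omega>. ?ce (indicat_real (stopped_at k \<inter> in_set n A)) \<omega> \<partial>Q)"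
      by (rule real_cond_exp_int(2)[OF iEB, symmetric])
    also have "\<dots> = (\<integral>\<omega>. stop_weight k \<omega> * ?ce ?B \<omega> \<partial>Q)"
      by (rule integral_cong_AE[OF _ _ ae]) (use stop_weight(2)[of k] in auto)
    also have "\<dots> = (\<integral>\<omega>. stop_weight k \<omega> * ?B \<omega> \<partial>Q)"
      by (rule real_cond_exp_intg(2)[OF iZB stop_weight(1)]) simp
    finally show ?thesis .
  qed
  also have "\<dots> = (\<integral>\<omega>. stop_weight k \<omega> * indicat_real A (X n \<omega>) \<partial>Q)"
    by (rule Bochner_Integration.integral_cong) (simp_all add: ind)
  finally show ?thesis .
qed

lemma integral_law:
  assumes "distr Q S (X n) = law_at P n \<mu>" "f \<in> borel_measurable S"
  shows "(\<integral>\<omega>. f (X n \<omega>) \<partial>Q) = (\<integral>x. (f x :: real) \<partial>law_at P n \<mu>)"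
  unfolding assms(1)[symmetric] using assms(2) by (subst integral_distr) simp_all

lemma distr_X: "distr Q S (X n) = law_at P n \<mu>"
proof (induction n)
  case 0
  then show ?case using chain by (simp add: markov_chain_def law_at_0)
next
  case (Suc n)
  show ?case
  proof (rule measure_eqI)
    note l = prob_algebraD[OF law_at_in_prob_algebra[OF initial kernel, of "Suc n"]]
    interpret l: prob_space "law_at P (Suc n) \<mu>" by (rule l(1))
    interpret d: prob_space "distr Q S (X (Suc n))" by (rule prob_space_distr) simp
    show "sets (distr Q S (X (Suc n))) = sets (law_at P (Suc n) \<mu>)" using l(2) by simp
    fix A assume "A \<in> sets (distr Q S (X (Suc n)))"
    then have A: "A \<in> sets S" by simp
    have "measure (distr Q S (X (Suc n))) A = prob (in_set (Suc n) A)"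
      using A by (simp add: measure_distr in_set_def vimage_def Int_def conj_commute)
    also have "\<dots> = (\<integral>\<omega>. 1 * indicat_real (in_set (Suc n) A) \<omega> \<partial>Q)" using A by simp
    also have "\<dots> = (\<integral>\<omega>. 1 * measure (P (X n \<omega>)) A \<partial>Q)" by (rule integral_step) (use A in auto)
    also have "\<dots> = measure (law_at P (Suc n) \<mu>) A"
      using integral_law[OF Suc measurable_kernel_measure[OF kernel A]] measure_law_at_Suc_kernel[OF kernel initial A] by simp
    finally show "emeasure (distr Q S (X (Suc n))) A = emeasure (law_at P (Suc n) \<mu>) A"
      by (simp add: l.emeasure_eq_measure d.emeasure_eq_measure)
  qed
qed

lemma prob_in_set: "A \<in> sets S \<Longrightarrow> prob (in_set n A) = measure (law_at P n \<mu>) A"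
  unfolding distr_X[symmetric]
  by (simp add: measure_distr in_set_def vimage_def Int_def conj_commute)

text \<open>On the event \<open>{T = k}\<close> the chain still moves according to \<open>P\<close>: the indicator is exchanged for the weight,
the Markov property is applied, and the weight is exchanged for the indicator again.\<close>

lemma prob_stopped_step:
  assumes "k \<le> n" and A: "A \<in> sets S"
  shows "prob (stopped_at k \<inter> in_set (Suc n) A)
    = (\<integral>\<omega>. indicat_real (stopped_at k) \<omega> * measure (P (X n \<omega>)) A \<partial>Q)"
proof -
  have "prob (stopped_at k \<inter> in_set (Suc n) A)
      = (\<integral>\<omega>. stop_weight k \<omega> * indicat_real A (X (Suc n) \<omega>) \<partial>Q)"
    using assms by (intro prob_stopped_in_set) auto
  also have "\<dots> = (\<integral>\<omega>. stop_weight k \<omega> * indicat_real (in_set (Suc n) A) \<omega> \<partial>Q)"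
    by (rule Bochner_Integration.integral_cong) (auto simp: in_set_def indicator_def)
  also have "\<dots> = (\<integral>\<omega>. stop_weight k \<omega> * measure (P (X n \<omega>)) A \<partial>Q)"
    by (rule integral_step[OF _ stop_weight(2) A])
      (rule measurable_from_subalg[OF subalgebra_history_mono[OF assms(1)] stop_weight(1)])
  also have "\<dots> = (\<integral>\<omega>. indicat_real (stopped_at k) \<omega> * measure (P (X n \<omega>)) A \<partial>Q)"
  proof (rule integral_weighted_eq[OF X_measurable X_measurable])
    fix B assume B: "B \<in> sets S"
    have "(\<integral>\<omega>. indicat_real (stopped_at k) \<omega> * indicat_real B (X n \<omega>) \<partial>Q)
        = (\<integral>\<omega>. indicat_real (stopped_at k \<inter> in_set n B) \<omega> \<partial>Q)"
      by (rule Bochner_Integration.integral_cong) (auto simp: in_set_def indicator_def)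
    also have "\<dots> = prob (stopped_at k \<inter> in_set n B)" using B by simp
    finally show "(\<integral>\<omega>. stop_weight k \<omega> * indicat_real B (X n \<omega>) \<partial>Q)
        = (\<integral>\<omega>. indicat_real (stopped_at k) \<omega> * indicat_real B (X n \<omega>) \<partial>Q)"
      using prob_stopped_in_set[OF assms(1) B] by simp
  qed (auto simp: stop_weight measurable_kernel_measure kernel A emeasure_eq_measure)
  finally show ?thesis .
qed

end

locale chain_with_strong_random_time = chain_with_random_time Q S P \<mu> X T
  for Q :: "'w measure" and S :: "'a measure" and P \<mu> X T +
  fixes \<nu> :: "'a measure"
  assumes target: "\<nu> \<in> space (prob_algebra S)"
    and strong: "\<And>n A. A \<in> sets S \<Longrightarrow> \<P>(\<omega> in Q. T \<omega> = enat n) \<noteq> 0 \<Longrightarrow>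
      \<P>(\<omega> in Q. X n \<omega> \<in> A \<bar> T \<omega> = enat n) = measure \<nu> A"
    and finite_time: "\<P>(\<omega> in Q. T \<omega> < \<infinity>) = 1"
begin

definition stop_prob :: "nat \<Rightarrow> real" where
  "stop_prob k = prob (stopped_at k)"

definition tail_prob :: "nat \<Rightarrow> real" where
  "tail_prob n = \<P>(\<omega> in Q. enat n < T \<omega>)"

lemma prob_stopped_now:
  assumes A: "A \<in> sets S"
  shows "prob (stopped_at k \<inter> in_set k A) = stop_prob k * measure \<nu> A"
proof (cases "stop_prob k = 0")
  case True
  have "prob (stopped_at k \<inter> in_set k A) \<le> prob (stopped_at k)"
    by (rule finite_measure_mono) auto
  with True show ?thesis using measure_nonneg[of Q "stopped_at k \<inter> in_set k A"]
    by (simp add: stop_prob_def)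
next
  case False
  have "stopped_at k \<inter> in_set k A = {\<omega> \<in> space Q. X k \<omega> \<in> A \<and> T \<omega> = enat k}"
    by (auto simp: stopped_at_def in_set_def)
  then show ?thesis
    using strong[OF A, of k] False
    by (simp add: cond_prob_def stop_prob_def stopped_at_def field_simps)
qed

text \<open>The defining property of a strong random time restarts the chain from \<open>\<nu>\<close> at the time \<open>T\<close>.\<close>

lemma prob_stopped_later:
  assumes "A \<in> sets S"
  shows "prob (stopped_at k \<inter> in_set (k + j) A) = stop_prob k * measure (law_at P j \<nu>) A"
  using assms
proof (induction j arbitrary: A)
  case 0
  then show ?case by (simp add: prob_stopped_now law_at_0)
next
  case (Suc j)
  note l = prob_algebraD[OF law_at_in_prob_algebra[OF target kernel, of j]]
  interpret l: prob_space "law_at P j \<nu>" by (rule l(1))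
  have "prob (stopped_at k \<inter> in_set (k + Suc j) A)
      = (\<integral>\<omega>. indicat_real (stopped_at k) \<omega> * measure (P (X (k + j) \<omega>)) A \<partial>Q)"
    using prob_stopped_step[of k "k + j" A] Suc.prems by simp
  also have "\<dots> = (\<integral>x. stop_prob k * measure (P x) A \<partial>law_at P j \<nu>)"
  proof (rule integral_weighted_eq[OF X_measurable])
    show "(\<lambda>x. x) \<in> law_at P j \<nu> \<rightarrow>\<^sub>M S" by (rule measurable_ident_sets[OF l(2)])
    fix B assume B: "B \<in> sets S"
    have "(\<integral>\<omega>. indicat_real (stopped_at k) \<omega> * indicat_real B (X (k + j) \<omega>) \<partial>Q)
        = (\<integral>\<omega>. indicat_real (stopped_at k \<inter> in_set (k + j) B) \<omega> \<partial>Q)"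
      by (rule Bochner_Integration.integral_cong) (auto simp: in_set_def indicator_def)
    also have "\<dots> = stop_prob k * measure (law_at P j \<nu>) B" using B Suc.IH by simp
    finally show "(\<integral>\<omega>. indicat_real (stopped_at k) \<omega> * indicat_real B (X (k + j) \<omega>) \<partial>Q)
        = (\<integral>x. stop_prob k * indicat_real B x \<partial>law_at P j \<nu>)"
      using sets.sets_into_space[OF B] by (simp add: l(3) Int_absorb2)
  qed (auto simp: measurable_kernel_measure kernel Suc.prems emeasure_eq_measure stop_prob_def)
  also have "\<dots> = stop_prob k * measure (law_at P (Suc j) \<nu>) A"
    by (simp add: measure_law_at_Suc_kernel[OF kernel target Suc.prems])
  finally show ?case .
qed

text \<open>Decomposition of the event \<open>X n \<in> A\<close> according to the value of \<open>T\<close>.\<close>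

lemma renewal_equation:
  assumes A: "A \<in> sets S"
  shows "measure (law_at P n \<mu>) A = conv stop_prob (\<lambda>j. measure (law_at P j \<nu>) A) n
    + \<P>(\<omega> in Q. X n \<omega> \<in> A \<and> enat n < T \<omega>)"
proof -
  have eq: "in_set n A = (\<Union>k\<in>{..n}. stopped_at k \<inter> in_set n A) \<union> {\<omega> \<in> space Q. X n \<omega> \<in> A \<and> enat n < T \<omega>}"
  proof (intro set_eqI iffI)
    fix \<omega> assume \<omega>: "\<omega> \<in> in_set n A"
    show "\<omega> \<in> (\<Union>k\<in>{..n}. stopped_at k \<inter> in_set n A) \<union> {\<omega> \<in> space Q. X n \<omega> \<in> A \<and> enat n < T \<omega>}"
      using \<omega> by (cases "T \<omega>") (auto simp: stopped_at_def in_set_def not_less)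
  qed (auto simp: in_set_def)
  have "measure (law_at P n \<mu>) A = prob (in_set n A)" by (simp add: prob_in_set[OF A])
  also have "\<dots> = prob (\<Union>k\<in>{..n}. stopped_at k \<inter> in_set n A) + \<P>(\<omega> in Q. X n \<omega> \<in> A \<and> enat n < T \<omega>)"
    by (subst eq, rule finite_measure_Union) (use A in \<open>auto simp: stopped_at_def\<close>)
  also have "prob (\<Union>k\<in>{..n}. stopped_at k \<inter> in_set n A) = (\<Sum>k\<le>n. prob (stopped_at k \<inter> in_set n A))"
    by (rule finite_measure_finite_Union) (use A in \<open>auto simp: disjoint_family_on_def stopped_at_def\<close>)
  also have "\<dots> = conv stop_prob (\<lambda>j. measure (law_at P j \<nu>) A) n"
    unfolding conv_def
  proof (rule sum.cong)
    fix k assume "k \<in> {..n}"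
    then show "prob (stopped_at k \<inter> in_set n A) = stop_prob k * measure (law_at P (n - k) \<nu>) A"
      using prob_stopped_later[OF A, of k "n - k"] by simp
  qed simp
  finally show ?thesis .
qed

lemma stop_prob_nonneg: "0 \<le> stop_prob k"
  by (simp add: stop_prob_def)

lemma stop_prob_sums: "stop_prob sums 1"
proof -
  have "(\<lambda>k. prob (stopped_at k)) sums prob (\<Union>k. stopped_at k)"
    by (rule finite_measure_UNION) (auto simp: disjoint_family_on_def stopped_at_def)
  moreover have "(\<Union>k. stopped_at k) = {\<omega> \<in> space Q. T \<omega> < \<infinity>}"
  proof (intro set_eqI)
    show "\<omega> \<in> (\<Union>k. stopped_at k) \<longleftrightarrow> \<omega> \<in> {\<omega> \<in> space Q. T \<omega> < \<infinity>}" for \<omega>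
      by (cases "T \<omega>") (auto simp: stopped_at_def)
  qed
  ultimately show ?thesis using finite_time by (simp add: stop_prob_def[abs_def])
qed

lemma tail_prob_nonneg: "0 \<le> tail_prob n"
  by (simp add: tail_prob_def)

text \<open>The renewal equation for the whole space.\<close>

lemma tail_prob_eq: "tail_prob n = 1 - (\<Sum>k\<le>n. stop_prob k)"
proof -
  have one: "measure (law_at P j \<rho>) (space S) = 1" if "\<rho> \<in> space (prob_algebra S)" for j \<rho>
    using prob_algebraD[OF law_at_in_prob_algebra[OF that kernel, of j]] prob_space.prob_space by metis
  have "{\<omega> \<in> space Q. X n \<omega> \<in> space S \<and> enat n < T \<omega>} = {\<omega> \<in> space Q. enat n < T \<omega>}"
    using measurable_space[OF X_measurable] by auto
  then show ?thesis
    using renewal_equation[OF sets.top, of n] by (simp add: one initial target conv_def tail_prob_def)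
qed

lemma tail_prob_tendsto: "tail_prob \<longlonglongrightarrow> 0"
proof -
  have "(\<lambda>n. 1 - (\<Sum>k\<le>n. stop_prob k)) \<longlonglongrightarrow> 1 - 1"
    using stop_prob_sums unfolding sums_def_le by (intro tendsto_diff tendsto_const)
  then show ?thesis by (simp add: tail_prob_eq[abs_def])
qed

lemma conv_stop_prob_le:
  assumes "A \<in> sets S"
  shows "conv stop_prob (\<lambda>j. measure (law_at P j \<nu>) A) n \<le> measure (law_at P n \<mu>) A"
  using renewal_equation[OF assms, of n] by simp

lemma conv_stop_prob_tendsto:
  assumes "\<mu> \<bind> P = \<mu>" and A: "A \<in> sets S"
  shows "conv stop_prob (\<lambda>j. measure (law_at P j \<nu>) A) \<longlonglongrightarrow> measure \<mu> A"
proof -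
  have "law_at P n \<mu> = \<mu>" for n by (induction n) (simp_all add: law_at_0 law_at_Suc assms(1))
  then have eq: "conv stop_prob (\<lambda>j. measure (law_at P j \<nu>) A) n
      = measure \<mu> A - \<P>(\<omega> in Q. X n \<omega> \<in> A \<and> enat n < T \<omega>)" for n
    using renewal_equation[OF A, of n] by simp
  have "(\<lambda>n. \<P>(\<omega> in Q. X n \<omega> \<in> A \<and> enat n < T \<omega>)) \<longlonglongrightarrow> 0"
  proof (rule tendsto_sandwich[OF _ _ tendsto_const tail_prob_tendsto])
    show "\<forall>\<^sub>F n in sequentially. \<P>(\<omega> in Q. X n \<omega> \<in> A \<and> enat n < T \<omega>) \<le> tail_prob n"
      unfolding tail_prob_def using A by (intro always_eventually allI finite_measure_mono) auto
  qed simp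
  from tendsto_diff[OF tendsto_const this, of "measure \<mu> A"] show ?thesis by (simp add: eq[abs_def])
qed

lemma summable_tail_prob:
  assumes "(\<integral>\<^sup>+\<omega>. ennreal_of_enat (T \<omega>) \<partial>Q) < \<infinity>"
  shows "summable tail_prob"
proof -
  have "(\<Sum>n. ennreal (tail_prob n)) = (\<integral>\<^sup>+\<omega>. ennreal_of_enat (T \<omega>) \<partial>Q)"
    by (simp add: nn_integral_enat_function[OF T_measurable] tail_prob_def emeasure_eq_measure)
  with assms show ?thesis
    by (intro summable_suminf_not_top) (auto simp: tail_prob_def)
qed

end

section \<open>Densities of the laws of the chain\<close>

context reversible_kernel
begin

lemma ip_one_right: "ip f (\<lambda>x. c) = c * (\<integral>x. f x \<partial>\<pi>)"
  by (simp add: ip_def mult.commute)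

lemma ip_indicator_one: "B \<in> sets S \<Longrightarrow> ip (\<lambda>x. c) (indicat_real B) = c * measure \<pi> B"
  using sets.sets_into_space[of B S] by (simp add: ip_def Int_absorb2)

text \<open>The excess of \<open>f\<close> over \<open>g\<close> has a nonpositive integral on the set where it is positive.\<close>

lemma AE_le_of_ip_indicator_le:
  assumes f: "f \<in> V" and g: "g \<in> V"
    and le: "\<And>B. B \<in> sets S \<Longrightarrow> ip f (indicat_real B) \<le> ip g (indicat_real B)"
  shows "AE x in \<pi>. f x \<le> g x"
proof -
  note [measurable] = bounded_functions_measurable[OF f] bounded_functions_measurable[OF g]
  define B where "B = {x \<in> space S. g x < f x}"
  have B[measurable]: "B \<in> sets S" unfolding B_def by measurable
  let ?d = "\<lambda>x. (f x - g x) * indicat_real B x"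
  have d: "?d \<in> V" by (intro bounded_functions_intros f g B)
  have "0 \<le> ?d x" for x by (simp add: B_def indicator_def)
  moreover have "(\<integral>x. ?d x \<partial>\<pi>) = 0"
  proof (rule antisym)
    have "(\<integral>x. ?d x \<partial>\<pi>) = ip f (indicat_real B) - ip g (indicat_real B)"
      using ip_diff_left[OF f g bounded_functions_indicator[OF B]] by (simp add: ip_def)
    then show "(\<integral>x. ?d x \<partial>\<pi>) \<le> 0" using le[OF B] by simp
    show "0 \<le> (\<integral>x. ?d x \<partial>\<pi>)" by (rule integral_nonneg_AE) (simp add: B_def indicator_def)
  qed
  ultimately have "AE x in \<pi>. ?d x = 0"
    using integral_nonneg_eq_0_iff_AE[OF integrable_V[OF d]] by simp
  then show ?thesis
    using AE_space by eventually_elim (auto simp: B_def indicator_def split: if_splits)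
qed

lemma bounded_density:
  assumes \<nu>: "\<nu> \<in> space (prob_algebra S)"
    and dom: "\<And>B. B \<in> sets S \<Longrightarrow> measure \<nu> B \<le> M * measure \<pi> B"
  obtains h where "h \<in> V" "\<And>x. 0 \<le> h x"
    "\<And>B. B \<in> sets S \<Longrightarrow> measure \<nu> B = ip h (indicat_real B)"
proof -
  interpret \<nu>: prob_space \<nu> by (rule prob_algebraD(1)[OF \<nu>])
  have ac: "absolutely_continuous \<pi> \<nu>"
    unfolding absolutely_continuous_def
  proof
    fix B assume "B \<in> null_sets \<pi>"
    then have B: "B \<in> sets S" "measure \<pi> B = 0" by (auto simp: measure_def)
    then have "measure \<nu> B = 0" using dom[of B] measure_nonneg[of \<nu> B] by simp
    then show "B \<in> null_sets \<nu>"
      using B(1) prob_algebraD(2)[OF \<nu>] by (simp add: null_sets_def \<nu>.emeasure_eq_measure)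
  qed
  obtain f where f: "f \<in> borel_measurable \<pi>" "density \<pi> f = \<nu>"
    using pi.Radon_Nikodym_finite_measure[OF \<nu>.finite_measure_axioms _ ac] prob_algebraD(2)[OF \<nu>]
    by auto
  have [measurable]: "f \<in> borel_measurable S"
    using f(1) by (simp add: measurable_cong_sets[OF sets_pi refl])
  have em: "ennreal (measure \<nu> B) = (\<integral>\<^sup>+x. f x * indicator B x \<partial>\<pi>)" if "B \<in> sets S" for B
    using that f by (metis \<nu>.emeasure_eq_measure emeasure_density sets_pi)
  \<comment> \<open>a nonnegative bound is needed to compare in \<open>ennreal\<close>\<close>
  define M' where "M' = max M 0"
  have dom': "measure \<nu> B \<le> M' * measure \<pi> B" if "B \<in> sets S" for B
    using dom[OF that] mult_right_mono[of M M' "measure \<pi> B"] by (simp add: M'_def)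
  define N where "N = {x \<in> space S. ennreal M' < f x}"
  have N [measurable]: "N \<in> sets S" unfolding N_def by measurable
  have "AE x in \<pi>. f x \<le> ennreal M'"
  proof -
    have "(\<integral>\<^sup>+x. (f x - ennreal M') * indicator N x \<partial>\<pi>)
        = (\<integral>\<^sup>+x. f x * indicator N x - ennreal M' * indicator N x \<partial>\<pi>)"
      by (intro nn_integral_cong) (simp add: indicator_def)
    also have "\<dots> = (\<integral>\<^sup>+x. f x * indicator N x \<partial>\<pi>) - (\<integral>\<^sup>+x. ennreal M' * indicator N x \<partial>\<pi>)"
    proof (rule nn_integral_diff)
      show "(\<integral>\<^sup>+x. ennreal M' * indicator N x \<partial>\<pi>) \<noteq> \<infinity>"
        by (simp add: nn_integral_cmult_indicator pi.emeasure_eq_measure ennreal_mult_eq_top_iff)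
    qed (auto simp: N_def indicator_def)
    also have "\<dots> = ennreal (measure \<nu> N) - ennreal (M' * measure \<pi> N)"
      by (simp add: em[symmetric] nn_integral_cmult_indicator pi.emeasure_eq_measure ennreal_mult' M'_def)
    also have "\<dots> = 0" using dom'[OF N] by (simp add: diff_eq_0_iff_ennreal ennreal_less_top ennreal_leI)
    finally have "AE x in \<pi>. (f x - ennreal M') * indicator N x = 0"
      by (subst (asm) nn_integral_0_iff_AE) auto
    then show ?thesis
      using AE_space
      by eventually_elim (auto simp: N_def indicator_def diff_eq_0_iff_ennreal split: if_splits)
  qed
  \<comment> \<open>truncation makes the density bounded at every point, and not only almost everywhere\<close>
  define h where "h = (\<lambda>x. enn2real (min (f x) (ennreal M')))"
  have hf: "AE x in \<pi>. ennreal (h x) = f x"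
    using \<open>AE x in \<pi>. f x \<le> ennreal M'\<close>
  proof eventually_elim
    fix x assume le: "f x \<le> ennreal M'"
    then have "f x < top" by (rule le_less_trans) simp
    with le show "ennreal (h x) = f x"
      by (simp add: h_def min_absorb1 ennreal_enn2real)
  qed
  have h: "h \<in> V"
  proof (rule bounded_functionsI[where C=M'])
    show "h \<in> borel_measurable S" unfolding h_def by measurable
    fix x
    have "enn2real (min (f x) (ennreal M')) \<le> enn2real (ennreal M')"
      by (rule enn2real_mono) auto
    moreover have "0 \<le> M'" by (simp add: M'_def)
    ultimately show "\<bar>h x\<bar> \<le> M'" by (simp add: h_def)
  qed
  moreover have h0: "0 \<le> h x" for x by (simp add: h_def)
  moreover have "measure \<nu> B = ip h (indicat_real B)" if B: "B \<in> sets S" for B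
  proof -
    have "ennreal (measure \<nu> B) = (\<integral>\<^sup>+x. ennreal (h x * indicat_real B x) \<partial>\<pi>)"
      unfolding em[OF B] using hf
      by (intro nn_integral_cong_AE) (auto elim!: eventually_mono simp: indicator_def)
    also have "\<dots> = ennreal (ip h (indicat_real B))"
      unfolding ip_def
      by (rule nn_integral_eq_integral)
        (use h h0 B in \<open>auto intro!: integrable_mult_V bounded_functions_indicator\<close>)
    finally show ?thesis
      by (simp add: ip_def h0 integral_nonneg_AE)
  qed
  ultimately show ?thesis using that[of h] by blast
qed

lemma integral_eq_ip:
  assumes \<mu>: "\<mu> \<in> space (prob_algebra S)" and h: "h \<in> V" "\<And>x. 0 \<le> h x"
    and dens: "\<And>B. B \<in> sets S \<Longrightarrow> measure \<mu> B = ip h (indicat_real B)"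
    and g: "g \<in> V"
  shows "(\<integral>x. g x \<partial>\<mu>) = ip h g"
proof -
  note s = prob_algebraD[OF \<mu>]
  interpret \<mu>: prob_space \<mu> by (rule s(1))
  have "(\<integral>x. 1 * g x \<partial>\<mu>) = (\<integral>x. h x * g x \<partial>\<pi>)"
  proof (rule integral_weighted_eq[where ?Y1.0="\<lambda>x. x" and ?Y2.0="\<lambda>x. x" and S=S])
    show "(\<lambda>x. x) \<in> \<mu> \<rightarrow>\<^sub>M S" "(\<lambda>x. x) \<in> \<pi> \<rightarrow>\<^sub>M S" by (rule measurable_ident_sets; simp add: s)+
    fix B assume B: "B \<in> sets S"
    show "(\<integral>x. 1 * indicat_real B x \<partial>\<mu>) = (\<integral>x. h x * indicat_real B x \<partial>\<pi>)"
      using dens[OF B] sets.sets_into_space[OF B] by (simp add: ip_def s(3) Int_absorb2)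
  qed (use h g in \<open>auto intro: integrable_V bounded_functions_measurable\<close>)
  then show ?thesis by (simp add: ip_def)
qed

lemma A_cong:
  assumes "\<And>y. y \<in> space S \<Longrightarrow> f y = g y" "x \<in> space S"
  shows "A f x = A g x"
  unfolding kernel_op_def
  using assms prob_algebraD(3)[OF kernel_in_prob_algebra[OF kernel assms(2)]]
  by (intro Bochner_Integration.integral_cong) auto

lemma A_nonneg: "(\<And>x. 0 \<le> f x) \<Longrightarrow> 0 \<le> A f x"
  by (simp add: kernel_op_def)

text \<open>By self-adjointness, a step of the chain acts on densities as the transition operator.\<close>

lemma law_at_density:
  assumes \<nu>: "\<nu> \<in> space (prob_algebra S)" and h: "h \<in> V" "\<And>x. 0 \<le> h x"
    and dens: "\<And>B. B \<in> sets S \<Longrightarrow> measure \<nu> B = ip h (indicat_real B)"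
    and B: "B \<in> sets S"
  shows "measure (law_at P n \<nu>) B = ip ((A ^^ n) h) (indicat_real B)"
proof -
  have pos: "0 \<le> (A ^^ n) h x" for n x
    by (induction n arbitrary: x) (auto intro: h A_nonneg)
  show ?thesis using B
  proof (induction n arbitrary: B)
    case 0
    then show ?case by (simp add: law_at_0 dens)
  next
    case (Suc n)
    note l = law_at_in_prob_algebra[OF \<nu> kernel]
    have hn: "(A ^^ n) h \<in> V" by (rule ip_A_funpow(1)[OF h(1) h(1)])
    have iB: "indicat_real B \<in> V" by (rule bounded_functions_indicator[OF Suc.prems])
    have "measure (law_at P (Suc n) \<nu>) B = (\<integral>x. A (indicat_real B) x \<partial>law_at P n \<nu>)"
      by (rule measure_law_at_Suc[OF kernel \<nu> Suc.prems])
    also have "\<dots> = ip ((A ^^ n) h) (A (indicat_real B))"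
      by (rule integral_eq_ip[OF l hn pos Suc.IH A_V[OF iB]])
    also have "\<dots> = ip ((A ^^ Suc n) h) (indicat_real B)"
      by (simp add: self_adjoint[OF hn iB])
    finally show ?case .
  qed
qed

lemma integral_A_funpow:
  assumes "h \<in> V"
  shows "(\<integral>x. (A ^^ n) h x \<partial>\<pi>) = (\<integral>x. h x \<partial>\<pi>)"
  using ip_A_funpow(1)[OF assms assms] by (induction n) (simp_all add: integral_A)

text \<open>Half of the powers can be moved to the other side.  For even \<open>n\<close> this leaves a square, and for odd
\<open>n\<close> one factor \<open>A\<close> remains in the middle; this is where nonnegativity of the spectrum enters.\<close>

lemma ip_A_funpow_nonneg:
  assumes nonneg: "nonneg_eigenvalues P \<pi>" and g: "g \<in> V"
  shows "0 \<le> ip ((A ^^ n) g) g"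
proof -
  obtain i where "n = i + i \<or> n = Suc (i + i)" by (metis add_Suc_right evenE mult_2 oddE Suc_eq_plus1)
  then show ?thesis
  proof
    assume "n = i + i"
    then have "ip ((A ^^ n) g) g = ip ((A ^^ i) g) ((A ^^ i) g)"
      using ip_A_funpow(2)[of "(A ^^ i) g" g i] ip_A_funpow(1)[OF g g] g by (simp add: funpow_add)
    then show ?thesis by (simp add: ip_self_nonneg)
  next
    assume "n = Suc (i + i)"
    then have "(A ^^ n) g = (A ^^ i) (A ((A ^^ i) g))" by (simp add: funpow_add funpow_swap1)
    then have "ip ((A ^^ n) g) g = ip (A ((A ^^ i) g)) ((A ^^ i) g)"
      using ip_A_funpow(2)[of "A ((A ^^ i) g)" g i] ip_A_funpow(1)[OF g g] g by (simp add: A_V)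
    then show ?thesis using ip_A_nonneg[OF nonneg ip_A_funpow(1)[OF g g]] by simp
  qed
qed

lemma A_funpow_diff_one:
  assumes h: "h \<in> V" and x: "x \<in> space S"
  shows "(A ^^ n) (\<lambda>y. h y - 1) x = (A ^^ n) h x - 1"
  using x
proof (induction n arbitrary: x)
  case (Suc n)
  have "A ((A ^^ n) (\<lambda>y. h y - 1)) x = A (\<lambda>y. (A ^^ n) h y - 1) x"
    by (rule A_cong[OF Suc.IH Suc.prems])
  also have "\<dots> = A ((A ^^ n) h) x - 1"
    using Suc.prems A_diff[OF ip_A_funpow(1)[OF h h] bounded_functions_const] by (simp add: A_const)
  finally show ?case by simp
qed simp

text \<open>For a probability density \<open>h\<close>, subtracting 1 from the autocorrelation amounts to replacing \<open>h\<close> by the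
centred function \<open>h - 1\<close>.\<close>

lemma autocorrelation_ge_1:
  assumes nonneg: "nonneg_eigenvalues P \<pi>" and h: "h \<in> V" and one: "(\<integral>x. h x \<partial>\<pi>) = 1"
  shows "1 \<le> ip ((A ^^ n) h) h"
proof -
  let ?c = "\<lambda>x::'a. 1 :: real" and ?hn = "(A ^^ n) h"
  have V: "?hn \<in> V" "?c \<in> V" by (auto intro: ip_A_funpow(1) h bounded_functions_const)
  have "0 \<le> ip ((A ^^ n) (\<lambda>x. h x - 1)) (\<lambda>x. h x - 1)"
    by (intro ip_A_funpow_nonneg[OF nonneg] bounded_functions_intros h)
  also have "\<dots> = ip (\<lambda>x. ?hn x - 1) (\<lambda>x. h x - 1)"
    by (rule ip_cong) (simp_all add: A_funpow_diff_one h)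
  also have "\<dots> = ip ?hn h - ip ?hn ?c - (ip ?c h - ip ?c ?c)"
    using V h by (simp add: ip_diff_left ip_diff_right bounded_functions_diff)
  also have "\<dots> = ip ?hn h - 1"
    using ip_commute[of ?c h] integral_A_funpow[OF h, of n] one
    by (simp add: ip_one_right pi.prob_space[simplified])
  finally show ?thesis by simp
qed

text \<open>The domination of measures says that \<open>\<Sum>k\<le>n. Q k A\<^sup>n\<^sup>-\<^sup>k h \<le> \<Sum>k. Q k\<close> almost everywhere.  Integrated
against \<open>h\<close> it bounds a sum of autocorrelations with the weights \<open>Q k\<close>, all of which are at least 1;
the one with \<open>k = 0\<close> is kept and the others are replaced by 1.\<close>

lemma autocorrelation_bound:
  assumes nonneg: "nonneg_eigenvalues P \<pi>" and h: "h \<in> V" "\<And>x. 0 \<le> h x"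
    and one: "(\<integral>x. h x \<partial>\<pi>) = 1"
    and Q: "\<And>k. 0 \<le> Q k" "summable Q" "Q 0 = 1"
    and dom: "\<And>B. B \<in> sets S \<Longrightarrow>
      conv Q (\<lambda>j. ip ((A ^^ j) h) (indicat_real B)) n \<le> suminf Q * measure \<pi> B"
  shows "ip ((A ^^ n) h) h - 1 \<le> (\<Sum>k. Q (k + Suc n))"
proof -
  let ?F = "\<lambda>x. \<Sum>k\<le>n. Q k * (A ^^ (n - k)) h x"
  have An: "(A ^^ j) h \<in> V" for j by (rule ip_A_funpow(1)[OF h(1) h(1)])
  have F_V: "?F \<in> V"
  proof -
    have "(\<lambda>x. \<Sum>k\<in>K. Q k * (A ^^ (n - k)) h x) \<in> V" if "finite K" for K
      using that
    proof (induction K)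
      case (insert k K)
      then show ?case
        using bounded_functions_add[OF bounded_functions_cmult[OF An] insert.IH, of "Q k" "n - k"]
        by simp
    qed (simp add: bounded_functions_const)
    then show ?thesis by simp
  qed
  have ip_F: "ip ?F g = conv Q (\<lambda>j. ip ((A ^^ j) h) g) n" if g: "g \<in> V" for g
  proof -
    have "ip ?F g = (\<integral>x. (\<Sum>k\<le>n. Q k * ((A ^^ (n - k)) h x * g x)) \<partial>\<pi>)"
      unfolding ip_def by (simp add: sum_distrib_right mult.assoc)
    also have "\<dots> = (\<Sum>k\<le>n. Q k * ip ((A ^^ (n - k)) h) g)"
      using integrable_mult_V[OF An g] by (subst Bochner_Integration.integral_sum) (auto simp: ip_def)
    finally show ?thesis by (simp add: conv_def)
  qed
  have "AE x in \<pi>. ?F x \<le> suminf Q"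
    by (rule AE_le_of_ip_indicator_le[OF F_V bounded_functions_const])
      (simp add: ip_F bounded_functions_indicator dom ip_indicator_one)
  then have "ip ?F h \<le> ip (\<lambda>x. suminf Q) h"
    unfolding ip_def
    by (intro integral_mono_AE integrable_mult_V F_V h(1) bounded_functions_const)
      (auto elim!: eventually_mono intro!: mult_right_mono h(2))
  also have "\<dots> = suminf Q"
    using ip_commute[of "\<lambda>x. suminf Q" h] by (simp add: ip_one_right one)
  finally have le: "conv Q (\<lambda>j. ip ((A ^^ j) h) h) n \<le> suminf Q" by (simp add: ip_F h(1))
  have "ip ((A ^^ n) h) h - 1 = Q 0 * ip ((A ^^ n) h) h - Q 0" by (simp add: Q(3))
  also have "\<dots> \<le> conv Q (\<lambda>j. ip ((A ^^ j) h) h) n - (\<Sum>k\<le>n. Q k)"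
  proof -
    have "(\<Sum>k\<in>{..n} - {0}. Q k) \<le> (\<Sum>k\<in>{..n} - {0}. Q k * ip ((A ^^ (n - k)) h) h)"
      using mult_left_mono[OF autocorrelation_ge_1[OF nonneg h(1) one] Q(1)]
      by (intro sum_mono) simp
    then show ?thesis by (simp add: conv_def sum.remove[of "{..n}" 0])
  qed
  also have "\<dots> \<le> suminf Q - (\<Sum>k\<le>n. Q k)" using le by simp
  also have "\<dots> = (\<Sum>k. Q (k + Suc n))"
    using suminf_split_initial_segment[OF Q(2), of "Suc n"] by (simp add: lessThan_Suc_atMost)
  finally show ?thesis .
qed

lemma L2_dist_sq_density:
  assumes \<mu>: "\<mu> \<in> space (prob_algebra S)" and h: "h \<in> V" and one: "(\<integral>x. h x \<partial>\<pi>) = 1"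
    and dens: "\<And>B. B \<in> sets S \<Longrightarrow> measure \<mu> B = ip h (indicat_real B)"
  shows "L2_dist_sq \<pi> \<mu> \<pi> = ennreal (ip h h - 1)"
proof -
  let ?d = "\<lambda>x. h x - 1"
  have d: "?d \<in> V" by (intro bounded_functions_intros h)
  have dd: "density_of_diff \<pi> \<mu> \<pi> ?d"
    unfolding density_of_diff_def
  proof safe
    show "integrable \<pi> ?d" by (rule integrable_V[OF d])
    fix B assume "B \<in> sets \<pi>"
    then have B: "B \<in> sets S" by simp
    have "ip ?d (indicat_real B) = measure \<mu> B - measure \<pi> B"
      using ip_diff_left[OF h bounded_functions_const bounded_functions_indicator[OF B]]
      by (simp add: dens B ip_indicator_one)
    then show "measure \<mu> B - measure \<pi> B = (LINT x:B|\<pi>. ?d x)"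
      by (simp add: set_lebesgue_integral_def ip_def mult.commute)
  qed
  define k where "k = (SOME k. density_of_diff \<pi> \<mu> \<pi> k)"
  have "density_of_diff \<pi> \<mu> \<pi> k" unfolding k_def by (rule someI[of "density_of_diff \<pi> \<mu> \<pi>", OF dd])
  with dd have kd: "AE x in \<pi>. k x = ?d x"
    by (intro density_unique_real) (auto simp: density_of_diff_def)
  have ac: "\<forall>B\<in>sets \<pi>. emeasure \<pi> B = 0 \<longrightarrow> measure \<mu> B - measure \<pi> B = 0"
  proof (intro ballI impI)
    fix B assume B: "B \<in> sets \<pi>" "emeasure \<pi> B = 0"
    then have "AE x in \<pi>. x \<notin> B" by (intro AE_not_in) (simp add: null_sets_def)
    then have "(LINT x:B|\<pi>. ?d x) = 0"
      unfolding set_lebesgue_integral_def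
      by (intro integral_eq_zero_AE) (auto elim!: eventually_mono)
    then show "measure \<mu> B - measure \<pi> B = 0" using dd B(1) by (simp add: density_of_diff_def)
  qed
  have "L2_dist_sq \<pi> \<mu> \<pi> = (\<integral>\<^sup>+x. ennreal ((k x)\<^sup>2) \<partial>\<pi>)"
    using ac unfolding L2_dist_sq_def k_def by simp
  also have "\<dots> = (\<integral>\<^sup>+x. ennreal (?d x * ?d x) \<partial>\<pi>)"
    using kd by (intro nn_integral_cong_AE) (auto elim!: eventually_mono simp: power2_eq_square)
  also have "\<dots> = ennreal (ip ?d ?d)"
    unfolding ip_def by (intro nn_integral_eq_integral integrable_mult_V d) simp
  also have "ip ?d ?d = ip h h - 1"
    using h bounded_functions_const[of 1 S] ip_commute[of "\<lambda>x. 1" h] one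
    by (simp add: ip_diff_left ip_diff_right bounded_functions_diff ip_one_right pi.prob_space[simplified])
  finally show ?thesis .
qed

text \<open>The case \<open>n = 0\<close> of the domination provides the bounded density \<open>h\<close> of \<open>\<nu>\<close>.  The density at time \<open>t\<close> is
\<open>A\<^sup>t h\<close>, with squared norm \<open>\<langle>A\<^sup>2\<^sup>t h, h\<rangle>\<close>: time \<open>t\<close> in the distance is time \<open>2 t\<close> in the
autocorrelation.\<close>

lemma L2_dist_sq_law_at_le:
  assumes nonneg: "nonneg_eigenvalues P \<pi>" and \<nu>: "\<nu> \<in> space (prob_algebra S)"
    and Q: "\<And>k. 0 \<le> Q k" "summable Q" "Q 0 = 1"
    and dom: "\<And>B n. B \<in> sets S \<Longrightarrow>
      conv Q (\<lambda>j. measure (law_at P j \<nu>) B) n \<le> suminf Q * measure \<pi> B"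
  shows "L2_dist_sq \<pi> (law_at P t \<nu>) \<pi> \<le> (\<Sum>k. ennreal (Q (2 * t + 1 + k)))"
proof -
  have "measure \<nu> B \<le> suminf Q * measure \<pi> B" if "B \<in> sets S" for B
    using dom[OF that, of 0] Q(3) by (simp add: conv_def law_at_0)
  then obtain h where h: "h \<in> V" "\<And>x. 0 \<le> h x"
      and dens: "\<And>B. B \<in> sets S \<Longrightarrow> measure \<nu> B = ip h (indicat_real B)"
    using bounded_density[OF \<nu>] by blast
  note law = law_at_density[OF \<nu> h dens]
  have one: "(\<integral>x. h x \<partial>\<pi>) = 1"
  proof -
    interpret \<nu>: prob_space \<nu> by (rule prob_algebraD(1)[OF \<nu>])
    have "ip h (indicat_real (space S)) = 1"
      using dens[OF sets.top] \<nu>.prob_space prob_algebraD(3)[OF \<nu>] by simp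
    moreover have "ip h (indicat_real (space S)) = ip h (\<lambda>x. 1)" by (rule ip_cong) auto
    ultimately show ?thesis by (simp add: ip_one_right)
  qed
  have ht: "(A ^^ t) h \<in> V" by (rule ip_A_funpow(1)[OF h(1) h(1)])
  have "L2_dist_sq \<pi> (law_at P t \<nu>) \<pi> = ennreal (ip ((A ^^ t) h) ((A ^^ t) h) - 1)"
    by (rule L2_dist_sq_density[OF law_at_in_prob_algebra[OF \<nu> kernel] ht])
      (simp_all add: integral_A_funpow h(1) one law)
  also have "ip ((A ^^ t) h) ((A ^^ t) h) = ip ((A ^^ (2 * t)) h) h"
    using ip_A_funpow(2)[OF ht h(1), of t] by (simp add: mult_2 funpow_add)
  also have "ennreal (ip ((A ^^ (2 * t)) h) h - 1) \<le> ennreal (\<Sum>k. Q (k + Suc (2 * t)))"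
    using autocorrelation_bound[OF nonneg h one Q, of "2 * t"] dom by (intro ennreal_leI) (simp add: law)
  also have "\<dots> = (\<Sum>k. ennreal (Q (2 * t + 1 + k)))"
    using Q(1,2) summable_ignore_initial_segment[OF Q(2), of "Suc (2 * t)"]
    by (subst suminf_ennreal2) (simp_all add: add.commute)
  finally show ?thesis .
qed

end

section \<open>Uniqueness of the stationary distribution and the convergence bound\<close>

theorem theorem1p2:
  fixes S :: "'a measure"
    and P :: "'a \<Rightarrow> 'a measure"
    and \<Omega> :: "'w measure"
    and Pr :: "'a measure \<Rightarrow> 'w measure"
    and X :: "nat \<Rightarrow> 'w \<Rightarrow> 'a"
    and T :: "'w \<Rightarrow> enat"
    and \<pi> \<nu> :: "'a measure"
  assumes kernel: "P \<in> S \<rightarrow>\<^sub>M prob_algebra S"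
    and Pr: "\<And>\<mu>. \<mu> \<in> space (prob_algebra S) \<Longrightarrow> Pr \<mu> \<in> space (prob_algebra \<Omega>)"
    and chain: "\<And>\<mu>. \<mu> \<in> space (prob_algebra S) \<Longrightarrow> markov_chain S P \<mu> (Pr \<mu>) X"
    and pi: "\<pi> \<in> space (prob_algebra S)"
    and rev: "reversible S P \<pi>"
    and nonneg: "nonneg_eigenvalues P \<pi>"
    and nu: "\<nu> \<in> space (prob_algebra S)"
    and strong: "strong_random_time S Pr X T \<nu>"
    and T_ge_1: "\<P>(\<omega> in Pr \<nu>. T \<omega> \<ge> 1) = 1"
    and T_integrable: "(\<integral>\<^sup>+\<omega>. ennreal_of_enat (T \<omega>) \<partial>Pr \<nu>) < \<infinity>"
    and T_finite: "\<And>\<mu>. \<mu> \<in> space (prob_algebra S) \<Longrightarrow> \<P>(\<omega> in Pr \<mu>. T \<omega> < \<infinity>) = 1"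
  shows "(\<forall>\<mu>. stationary_distribution S P \<mu> \<longleftrightarrow> \<mu> = \<pi>) \<and>
         (\<forall>t::nat. L2_dist_sq \<pi> (law_at P t \<nu>) \<pi>
            \<le> (\<Sum>k. ennreal (\<P>(\<omega> in Pr \<nu>. T \<omega> > enat (2 * t + 1 + k)))))"
proof -
  interpret R: reversible_kernel S P \<pi>
    by (rule reversible_kernel.intro[OF kernel pi rev])
  have C: "chain_with_strong_random_time (Pr \<mu>) S P \<mu> X T \<nu>" if \<mu>: "\<mu> \<in> space (prob_algebra S)" for \<mu>
    unfolding chain_with_strong_random_time_def chain_with_strong_random_time_axioms_def
      chain_with_random_time_def chain_with_random_time_axioms_def
    using chain[OF \<mu>] \<mu> kernel nu T_finite[OF \<mu>] strong
    by (auto simp: strong_random_time_def markov_chain_def)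
  interpret N: chain_with_strong_random_time "Pr \<nu>" S P \<nu> X T \<nu> by (rule C[OF nu])
  interpret I: chain_with_strong_random_time "Pr \<pi>" S P \<pi> X T \<nu> by (rule C[OF pi])
  let ?a = "\<lambda>B j. measure (law_at P j \<nu>) B"
  \<comment> \<open>the chain started from \<open>\<pi>\<close> supplies the averaging weights\<close>
  have limit: "conv I.stop_prob (?a B) \<longlonglongrightarrow> measure \<pi> B" if "B \<in> sets S" for B
    by (rule I.conv_stop_prob_tendsto[OF R.stationary_pi that])
  have unique: "\<mu> = \<pi>" if st: "stationary_distribution S P \<mu>" for \<mu>
  proof -
    have \<mu>: "\<mu> \<in> space (prob_algebra S)" "\<mu> \<bind> P = \<mu>"
      using st by (auto simp: stationary_distribution_def)
    interpret M: chain_with_strong_random_time "Pr \<mu>" S P \<mu> X T \<nu> by (rule C[OF \<mu>(1)])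
    interpret \<mu>: prob_space \<mu> by (rule prob_algebraD(1)[OF \<mu>(1)])
    show ?thesis
    proof (rule measure_eqI)
      show "sets \<mu> = sets \<pi>" using prob_algebraD(2)[OF \<mu>(1)] by simp
      fix B assume "B \<in> sets \<mu>"
      then have B: "B \<in> sets S" using prob_algebraD(2)[OF \<mu>(1)] by simp
      have "measure \<mu> B = measure \<pi> B"
        by (rule conv_limits_agree[OF M.stop_prob_sums M.stop_prob_nonneg I.stop_prob_sums
              I.stop_prob_nonneg M.conv_stop_prob_tendsto[OF \<mu>(2) B] limit[OF B]])
      then show "emeasure \<mu> B = emeasure \<pi> B"
        by (simp add: \<mu>.emeasure_eq_measure R.pi.emeasure_eq_measure)
    qed
  qed
  have q0: "N.stop_prob 0 = 0"
  proof -
    have "{\<omega> \<in> space (Pr \<nu>). T \<omega> \<ge> 1} \<inter> N.stopped_at 0 = {}"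
      by (auto simp: N.stopped_at_def zero_enat_def[symmetric])
    then have "N.prob ({\<omega> \<in> space (Pr \<nu>). T \<omega> \<ge> 1} \<union> N.stopped_at 0) = 1 + N.stop_prob 0"
      unfolding N.stop_prob_def T_ge_1[symmetric]
      by (intro N.finite_measure_Union) auto
    moreover have "N.prob ({\<omega> \<in> space (Pr \<nu>). T \<omega> \<ge> 1} \<union> N.stopped_at 0) \<le> 1" by (rule N.prob_le_1)
    ultimately show ?thesis using N.stop_prob_nonneg[of 0] by linarith
  qed
  have tail: "N.tail_prob 0 = 1" "\<And>n. N.tail_prob n = N.tail_prob (Suc n) + N.stop_prob (Suc n)"
      "\<And>n. 0 \<le> N.tail_prob n" "summable N.tail_prob"
    using q0 N.summable_tail_prob[OF T_integrable] N.tail_prob_nonneg by (simp_all add: N.tail_prob_eq)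
  have dom: "conv N.tail_prob (?a B) n \<le> suminf N.tail_prob * measure \<pi> B" if B: "B \<in> sets S" for B n
  proof (rule conv_tail_le[OF q0 tail(2,1,3,4) _ _ _ I.stop_prob_sums I.stop_prob_nonneg limit[OF B]])
    show "?a B n \<le> 1" for n
      using prob_algebraD(1)[OF law_at_in_prob_algebra[OF nu kernel]] by (rule prob_space.prob_le_1)
    show "conv N.stop_prob (?a B) n \<le> ?a B n" for n by (rule N.conv_stop_prob_le[OF B])
  qed simp
  have "L2_dist_sq \<pi> (law_at P t \<nu>) \<pi> \<le> (\<Sum>k. ennreal (\<P>(\<omega> in Pr \<nu>. T \<omega> > enat (2 * t + 1 + k))))" for t
    by (rule R.L2_dist_sq_law_at_le[OF nonneg nu tail(3,4,1) dom, unfolded N.tail_prob_def])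
  moreover have "stationary_distribution S P \<pi>"
    using pi R.stationary_pi by (simp add: stationary_distribution_def)
  ultimately show ?thesis using unique by blast
qed

end
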